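(* Consider the distributed problem $\min_{x\in\mathbb{R}^d} f(x)=\sum_{i=1}^n f_i(x)$ and the q-PDGD algorithm with constant step-size $h$ (both described in the context). Assume: (1) $X^*=\arg\min_{x\in\mathbb{R}^d} f(x)$ is nonempty and convex; (2) each $f_i:\mathbb{R}^d\to\mathbb{R}$ is continuously differentiable and $\|\nabla f_i(a)-\nabla f_i(b)\|\le L_{f_i}\|a-b\|$ for all $a,b\in\mathbb{R}^d$, with $L_{f_i}>0$; put $L_f=\max_i L_{f_i}$; (3) (restricted secant inequality) there is $\nu>0$ with $(\nabla f(x)-\nabla f(\mathcal{P}_{X^*}(x)))^\top(x-\mathcal{P}_{X^*}(x))\ge \nu\|x-\mathcal{P}_{X^*}(x)\|^2$ for all $x\in\mathbb{R}^d$; (4) the set $\{\nabla F(\mathbf{x}):\mathbf{x}\in\mathcal{X}^*\}$ is a singleton; (5) the communication graph is undirected and connected; (6) the stochastic gradients are $g_i(x_i(k))=\nabla f_i(x_i(k))+\zeta_i(k)$ with $\mathbb{E}[\zeta_i(k)\mid\mathcal{F}_k]=0$ and $\mathbb{E}[\|\zeta_i(k)\|^2\mid\mathcal{F}_k]\le\sigma^2$ for all $i$ and $k$. Let the parameters satisfy $\alpha>\frac{2nL_f^2+\nu L_f}{\nu\rho_2(L)}$, $\beta>0$ and $0<h<\min\left\{\frac{2\epsilon_2\epsilon_4}{\eta\epsilon_3\epsilon_5},\frac{2\epsilon_3}{\epsilon_2}\right\}$. Then $$\rho:=1-\frac{h(2\epsilon_2\epsilon_4-h\eta\epsilon_3\epsilon_5)}{4\epsilon_3\epsilon_4}\in(0,1),$$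 and there exists a constant $C>0$ such that for all $k\ge 0$ $$\mathbb{E}\left[\|\mathbf{x}(k)-\mathcal{P}_{\mathcal{X}^*}(\mathbf{x}(k))\|\right]\le C\rho^k+\sqrt{A\Delta^2+B\sigma^2}.$$ Here $\epsilon_1,\dots,\epsilon_5,\eta,A,B$ are the explicit constants defined in the context.
   Context: **Notation.** $\|\cdot\|$ is the Euclidean norm; $\otimes$ is the Kronecker product; $\mathbf{1}_n$ is the all-ones vector in $\mathbb{R}^n$; $\mathcal{P}_S(x)=\arg\min_{y\in S}\|x-y\|^2$ is the projection onto $S$. Stacked quantities: $\mathbf{x}=\mathrm{col}(x_1,\dots,x_n)\in\mathbb{R}^{nd}$ with $x_i\in\mathbb{R}^d$, $F(\mathbf{x})=\sum_{i=1}^n f_i(x_i)$, $\mathcal{X}^*=\{\mathbf{1}_n\otimes x^*: x^*\in X^*\}$. **Network.** There are $n$ agents on a weighted undirected graph with symmetric adjacency matrix $(a_{ij})$, $a_{ij}\ge0$, $a_{ii}=0$; $i,j$ are adjacent iff $a_{ij}>0$. $L=(L_{ij})=D-(a_{ij})$ is the weighted Laplacian, $D$ the diagonal matrix of weighted degrees $\sum_j a_{ij}$. $\rho(L)$ is the spectral radius of $L$ and $\rho_2(L)$ its smallest nonzero eigenvalue. **Random quantizer.** Given $[l,u]$ and $b$ bits, let $\Delta=(u-l)/(2^b-1)$ and let $\tau_1=l<\dots<\tau_{2^b}=u$ be equally spaced with spacing $\Delta$. For $x\in[\tau_i,\tau_{i+1})$ and $p=(x-\tau_i)/\Delta$, $Q(x)=\tau_i$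 with probability $1-p$ and $Q(x)=\tau_{i+1}$ with probability $p$; $Q$ is applied element-wise to vectors. **Algorithm q-PDGD.** With positive parameters $\alpha,\beta,h$, arbitrary $x_i(0)\in\mathbb{R}^d$, and $v_i(0)=0$, for $k\ge0$ and each agent $i$: $$x_i(k+1)=x_i(k)-h\Big(\alpha\sum_{j=1}^nL_{ij}Q(x_j(k))+\beta v_i(k)+g_i(x_i(k))\Big),$$ $$v_i(k+1)=v_i(k)+h\beta\sum_{j=1}^nL_{ij}Q(x_j(k)),$$ where at each iteration the same realization $Q(x_j(k))$ is used everywhere, and $g_i(x_i(k))$ is a stochastic gradient. $\mathcal{F}_k$ is the filtration containing the history of all variables generated up to iteration $k$ (so $x_i(k),v_i(k)$ are $\mathcal{F}_k$-measurable). $\mathbb{E}[\cdot]$ is expectation over the randomness of the stochastic gradients and the quantization. **Quantization noise (standing).** $\varepsilon_i(k)=Q(x_i(k))-x_i(k)$ satisfies $\mathbb{E}[\varepsilon_i(k)\mid\mathcal{F}_k]=0$ and $\mathbb{E}[\|\varepsilon_i(k)\|^2\mid\mathcal{F}_k]\le d\Delta^2/4$ for all $i,k$ (properties of the random quantizer $Q$ with levels $\tau_1,\dots,\tau_{2^b}$ for inputs with coordinates in $[l,u]$). **Constants.** - $\nu_1=\min\left\{\frac{\nu}{2n},\ \alpha\rho_2(L)-\frac{2nL_f^2+\nu L_f}{\nu}\right\}$, - $\epsilon_1=\max\left\{\frac{1}{\nu_1}\left(\frac{L_f^2}{2\beta}+\beta\rho(L)\right),\frac12\right\}$, - $\epsilon_2=\min\left\{\frac{\beta}{2},\epsilon_1\nu_1\right\}$,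 - $\epsilon_3=\max\left\{\epsilon_1+\frac12,\ \frac{\epsilon_1}{\rho_2(L)}+\frac{\alpha}{2\beta}+\frac12\right\}$, - $\epsilon_4=\min\left\{\epsilon_1-\frac12,\ \frac{\alpha}{2\beta}-\frac12\right\}$, - $\epsilon_5=\max\{\beta^2\rho^2(L)+3\alpha^2\rho^2(L)+3L_f^2,\ 3\beta^2\}$, - $\eta=\sqrt2\max\left\{\frac{2\epsilon_1}{\rho_2(L)}+\alpha+1,\ 4\epsilon_1+1\right\}$, - $A=\left(\frac{\epsilon_3\eta h}{2\epsilon_2\epsilon_4-h\eta\epsilon_3\epsilon_5}\right)\frac{nd}{4}(2\alpha^2+\beta^2)\rho^2(L)$, - $B=\left(\frac{\epsilon_3\eta h}{2\epsilon_2\epsilon_4-h\eta\epsilon_3\epsilon_5}\right)2n$. Here $\rho^2(L)=(\rho(L))^2$; the number $\rho$ in the claim is distinct from the function $\rho(\cdot)$. *)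

theory Defs
  imports "HOL-Probability.Probability"
begin

definition grad :: "('a::real_inner \<Rightarrow> real) \<Rightarrow> 'a \<Rightarrow> 'a" where
  "grad f x = (THE D. GDERIV f x :> D)"

definition argmin_set :: "('a \<Rightarrow> real) \<Rightarrow> 'a set" where
  "argmin_set f = {x. is_arg_min f (\<lambda>_. True) x}"

definition weighted_undirected :: "real ^ 'n ^ 'n \<Rightarrow> bool" where
  "weighted_undirected a \<longleftrightarrow>
     (\<forall>i j. a $ i $ j = a $ j $ i) \<and> (\<forall>i j. 0 \<le> a $ i $ j) \<and> (\<forall>i. a $ i $ i = 0)"

definition graph_connected :: "real ^ 'n ^ 'n \<Rightarrow> bool" where
  "graph_connected a \<longleftrightarrow> (\<forall>i j. (i, j) \<in> {(i, j). 0 < a $ i $ j}\<^sup>*)"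

definition laplacian :: "real ^ 'n ^ 'n \<Rightarrow> real ^ 'n ^ 'n" where
  "laplacian a = (\<chi> i j. (if i = j then \<Sum>k\<in>UNIV. a $ i $ k else 0)) - a"

definition spectrum :: "real ^ 'n ^ 'n \<Rightarrow> complex set" where
  "spectrum A = {z. \<exists>v. v \<noteq> 0 \<and> map_matrix complex_of_real A *v v = z *s v}"

definition spectral_radius :: "real ^ 'n ^ 'n \<Rightarrow> real" where
  "spectral_radius A = Max (cmod ` spectrum A)"

text \<open>Meant for matrices with real spectrum and at least one nonzero eigenvalue, such as the
  Laplacian of a connected graph with at least two vertices.\<close>

definition least_nonzero_eigenvalue :: "real ^ 'n ^ 'n \<Rightarrow> real" where
  "least_nonzero_eigenvalue A = Min {r. r \<noteq> 0 \<and> complex_of_real r \<in> spectrum A}"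

text \<open>The library's conditional expectation is scalar, hence the condition by coordinates.
  It is meaningful for integrable noise; the second-moment bound below supplies integrability.\<close>

definition cond_mean_zero :: "'w measure \<Rightarrow> 'w measure \<Rightarrow> ('w \<Rightarrow> real ^ 'd) \<Rightarrow> bool" where
  "cond_mean_zero M G \<xi> \<longleftrightarrow> (\<forall>c. AE \<omega> in M. real_cond_exp M G (\<lambda>\<omega>. \<xi> \<omega> $ c) \<omega> = 0)"

text \<open>Stated with the nonnegative conditional expectation, which is infinite, not a default
  value, where the second moment does not exist; so the bound entails square integrability.\<close>

definition cond_second_moment_le ::
    "'w measure \<Rightarrow> 'w measure \<Rightarrow> ('w \<Rightarrow> real ^ 'd) \<Rightarrow> real \<Rightarrow> bool" where
  "cond_second_moment_le M G \<xi> s \<longleftrightarrow>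
     (AE \<omega> in M. nn_cond_exp M G (\<lambda>\<omega>. ennreal ((norm (\<xi> \<omega>))\<^sup>2)) \<omega> \<le> ennreal s)"

definition quant_step :: "real \<Rightarrow> real \<Rightarrow> nat \<Rightarrow> real" where
  "quant_step l u b = (u - l) / (2 ^ b - 1)"

text \<open>The levels are indexed from 1: level 1 is \<open>l\<close> and level \<open>2 ^ b\<close> is \<open>u\<close>.\<close>

definition quant_level :: "real \<Rightarrow> real \<Rightarrow> nat \<Rightarrow> nat \<Rightarrow> real" where
  "quant_level l u b i = l + (real i - 1) * quant_step l u b"

text \<open>The law of \<open>Q(x)\<close> for \<open>x\<close> between \<open>l\<close> and \<open>u\<close>. For \<open>x = u\<close> the index is \<open>2 ^ b\<close> and
  \<open>p = 0\<close>, so \<open>Q(u) = u\<close>.\<close>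

definition quantizer_pmf :: "real \<Rightarrow> real \<Rightarrow> nat \<Rightarrow> real \<Rightarrow> real pmf" where
  "quantizer_pmf l u b x =
     (let i = nat \<lfloor>(x - l) / quant_step l u b\<rfloor> + 1;
          p = (x - quant_level l u b i) / quant_step l u b
      in map_pmf (\<lambda>up. if up then quant_level l u b (i + 1) else quant_level l u b i)
           (bernoulli_pmf p))"

text \<open>Given \<open>G\<close>, every entry of \<open>q\<close> has the law of the quantizer at the corresponding entry of
  \<open>x\<close>, wherever that entry lies in the quantizer's input range. Joint laws of different entries
  are left unrestricted.\<close>

definition quantizes ::
    "'w measure \<Rightarrow> 'w measure \<Rightarrow> real \<Rightarrow> real \<Rightarrow> nat \<Rightarrow>
     ('w \<Rightarrow> real ^ 'd ^ 'n) \<Rightarrow> ('w \<Rightarrow> real ^ 'd ^ 'n) \<Rightarrow> bool" where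
  "quantizes M G l u b x q \<longleftrightarrow>
     (\<forall>i c t. AE \<omega> in M. x \<omega> $ i $ c \<in> {l..u} \<longrightarrow>
        real_cond_exp M G (indicator {\<omega> \<in> space M. q \<omega> $ i $ c = t}) \<omega>
          = pmf (quantizer_pmf l u b (x \<omega> $ i $ c)) t)"

text \<open>\<open>q k\<close> is the realization of the quantized iterate \<open>Q(x(k))\<close>, shared by both updates, and
  \<open>g k\<close> collects the stochastic gradients.\<close>

definition q_pdgd ::
    "'w measure \<Rightarrow> real ^ 'n ^ 'n \<Rightarrow> real \<Rightarrow> real \<Rightarrow> real \<Rightarrow> real ^ 'd ^ 'n \<Rightarrow>
     (nat \<Rightarrow> 'w \<Rightarrow> real ^ 'd ^ 'n) \<Rightarrow> (nat \<Rightarrow> 'w \<Rightarrow> real ^ 'd ^ 'n) \<Rightarrow>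
     (nat \<Rightarrow> 'w \<Rightarrow> real ^ 'd ^ 'n) \<Rightarrow> (nat \<Rightarrow> 'w \<Rightarrow> real ^ 'd ^ 'n) \<Rightarrow> bool" where
  "q_pdgd M L \<alpha> \<beta> h x0 x v q g \<longleftrightarrow>
     (\<forall>\<omega>\<in>space M.
        x 0 \<omega> = x0 \<and> v 0 \<omega> = 0 \<and>
        (\<forall>k i.
          x (Suc k) \<omega> $ i = x k \<omega> $ i -
            h *\<^sub>R (\<alpha> *\<^sub>R (\<Sum>j\<in>UNIV. L $ i $ j *\<^sub>R q k \<omega> $ j) + \<beta> *\<^sub>R v k \<omega> $ i + g k \<omega> $ i) \<and>
          v (Suc k) \<omega> $ i = v k \<omega> $ i + (h * \<beta>) *\<^sub>R (\<Sum>j\<in>UNIV. L $ i $ j *\<^sub>R q k \<omega> $ j)))"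

end

theory Submission
  imports Defs
begin

text \<open>
  The iteration is read as a noisy Euler discretization of a primal-dual flow and is controlled by
  one Lyapunov function. Let \<open>T\<close> be the Laplacian acting on stacked vectors, \<open>\<Phi>\<close> the stacked
  gradient and \<open>dev x\<close> the vector from the closest stacked minimizer to \<open>x\<close>. All stacked minimizers
  are consensus vectors, so \<open>T\<close> kills them, and they share one value \<open>\<Phi>0\<close> of \<open>\<Phi>\<close>, which is orthogonal to
  consensus because the gradients of the summands add up to zero at a minimizer. Hence \<open>- \<Phi>0 / \<beta>\<close> is
  the limit to expect for \<open>v\<close>, and the dual error \<open>v + \<Phi>0 / \<beta>\<close> stays in the range of \<open>T\<close>. Writing it
  as \<open>T w\<close>, where \<open>w\<close> simply accumulates the quantized iterates, avoids the pseudo-inverse of \<open>T\<close>. The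
  Lyapunov function is
  \<open>V = \<epsilon>1 * (norm (dev x))\<^sup>2 + \<epsilon>1 * (w \<bullet> T w) + T w \<bullet> x + \<alpha> / (2 * \<beta>) * (norm (T w))\<^sup>2\<close>.

  To first order in \<open>h\<close>, the first two terms dissipate the primal error: their cross terms
  cancel, and what remains is bounded below by \<open>restricted_secant_stacked\<close>, which combines the
  restricted secant inequality in the consensus direction with the spectral gap of \<open>T\<close> in the
  directions of disagreement. The cross term \<open>T w \<bullet> x\<close> dissipates the dual error, and the last term
  cancels the one indefinite contribution that this costs (\<open>drift_dissipates\<close>). To second order in
  \<open>h\<close>, \<open>V\<close> grows at most like the square of the step (\<open>V_increment\<close>; the squared distance to a convex
  set is bounded by the one to the old projection). The noise enters linearly, with weights that
  depend on the past, and quadratically. The linear part has expectation zero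
  (\<open>integral_inner_noise\<close>), the quadratic part is bounded by the second moments, and so the
  expectation of \<open>V\<close> satisfies an affine recursion with factor \<open>1 - 2 * (1 - \<rho>)\<close>
  (\<open>V_contracts\<close>, \<open>expected_V_contracts\<close>). Its fixed point, divided by \<open>\<epsilon>4\<close>, is exactly
  \<open>A * \<Delta>\<^sup>2 + B * \<sigma>\<^sup>2\<close>. Since \<open>V\<close> dominates \<open>\<epsilon>4\<close> times the squared distance to the stacked minimizers,
  Jensen's inequality and a square root halve the exponent, which gives the rate \<open>\<rho>\<close>.

  The spectral quantities enter through two inequalities: the norm of \<open>T\<close> is at most the spectral
  radius, and \<open>T\<close> is bounded below by the least nonzero eigenvalue on the complement of consensus.
  Both come from minimizing a Rayleigh quotient over a sphere.
\<close>

section \<open>Extremal eigenvalues of self-adjoint operators\<close>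

text \<open>A minimizer of the Rayleigh quotient on the unit sphere of an invariant subspace exists by
  compactness, and stationarity makes it an eigenvector. The invariant subspace is what allows the
  kernel to be left out later.\<close>

lemma self_adjoint_min_eigenvector:
  fixes T :: "'a::euclidean_space \<Rightarrow> 'a"
  assumes T: "linear T" "\<And>x y. x \<bullet> T y = T x \<bullet> y"
    and S: "subspace S" "T ` S \<subseteq> S" "S \<noteq> {0}"
  obtains w \<mu> where "w \<in> S" "norm w = 1" "T w = \<mu> *\<^sub>R w"
    "\<And>y. y \<in> S \<Longrightarrow> \<mu> * (norm y)\<^sup>2 \<le> y \<bullet> T y"
proof -
  interpret T: linear T by (rule T(1))
  let ?C = "sphere 0 1 \<inter> S"
  have "compact ?C"
    by (intro compact_Int_closed compact_sphere closed_subspace S(1))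
  moreover have "?C \<noteq> {}"
  proof -
    obtain s where s: "s \<in> S" "s \<noteq> 0" using S(3) subspace_0[OF S(1)] by blast
    then have "s /\<^sub>R norm s \<in> ?C" using S(1) by (simp add: subspace_scale)
    then show ?thesis by blast
  qed
  moreover have "continuous_on ?C (\<lambda>y. y \<bullet> T y)"
    by (intro continuous_intros linear_continuous_on linear_conv_bounded_linear[THEN iffD1] T(1))
  ultimately obtain w where w: "w \<in> ?C" and w_min: "\<And>y. y \<in> ?C \<Longrightarrow> w \<bullet> T w \<le> y \<bullet> T y"
    using continuous_attains_inf[of ?C "\<lambda>y. y \<bullet> T y"] by metis
  define \<mu> where "\<mu> = w \<bullet> T w"
  have min: "\<mu> * (norm y)\<^sup>2 \<le> y \<bullet> T y" if y: "y \<in> S" for y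
  proof (cases "y = 0")
    case False
    then have "y /\<^sub>R norm y \<in> ?C" using S(1) y by (simp add: subspace_scale)
    from w_min[OF this] have "\<mu> \<le> (y \<bullet> T y) / (norm y)\<^sup>2"
      by (simp add: \<mu>_def T.scaleR power2_eq_square divide_inverse mult_ac)
    then have "\<mu> * (norm y)\<^sup>2 \<le> (y \<bullet> T y) / (norm y)\<^sup>2 * (norm y)\<^sup>2"
      by (intro mult_right_mono) auto
    then show ?thesis using False by simp
  qed (simp add: T.zero)
  define r where "r = T w - \<mu> *\<^sub>R w"
  have wS: "w \<in> S" and w1: "norm w = 1" using w by auto
  have rS: "r \<in> S" unfolding r_def using S wS by (auto intro!: subspace_diff subspace_scale)
  have ww: "w \<bullet> w = 1" using w1 by (simp add: dot_square_norm)
  have wr: "w \<bullet> r = 0" by (simp add: r_def inner_diff_right \<mu>_def ww)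
  have rw: "r \<bullet> T w = r \<bullet> r" using wr by (simp add: r_def inner_diff_right inner_commute)
  \<comment> \<open>Stationarity at \<open>w\<close>: moving from \<open>w\<close> along the residual \<open>r\<close> cannot lower the Rayleigh
    quotient, although its first-order change is \<open>2 * t * (norm r)\<^sup>2\<close>.\<close>
  define c where "c = r \<bullet> T r - \<mu> * (r \<bullet> r)"
  have min': "\<mu> * (y \<bullet> y) \<le> y \<bullet> T y" if "y \<in> S" for y
    using min[OF that] by (simp only: dot_square_norm)
  have q: "0 \<le> 2 * t * (r \<bullet> r) + t\<^sup>2 * c" for t
  proof -
    have "w + t *\<^sub>R r \<in> S" using S(1) wS rS by (simp add: subspace_add subspace_scale)
    note quotient = min'[OF this]
    have "(w + t *\<^sub>R r) \<bullet> (w + t *\<^sub>R r) = 1 + t\<^sup>2 * (r \<bullet> r)"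
      using wr ww inner_commute[of r w]
      by (simp add: inner_left_distrib inner_right_distrib power2_eq_square)
    moreover have "(w + t *\<^sub>R r) \<bullet> T (w + t *\<^sub>R r) = \<mu> + 2 * t * (r \<bullet> r) + t\<^sup>2 * (r \<bullet> T r)"
    proof -
      have "w \<bullet> T r = r \<bullet> r" using T(2)[of w r] rw inner_commute[of "T w" r] by simp
      then show ?thesis
        using rw by (simp add: T.add T.scaleR \<mu>_def power2_eq_square algebra_simps)
    qed
    ultimately have "\<mu> * (1 + t\<^sup>2 * (r \<bullet> r)) \<le> \<mu> + 2 * t * (r \<bullet> r) + t\<^sup>2 * (r \<bullet> T r)"
      using quotient by simp
    then show ?thesis by (simp add: c_def algebra_simps)
  qed
  have c0: "0 \<le> c" using min'[OF rS] by (simp add: c_def)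
  have "r \<bullet> r \<le> 0"
  proof (rule ccontr)
    assume "\<not> ?thesis"
    then have rr: "0 < r \<bullet> r" by (simp only: not_le)
    define t where "t = (r \<bullet> r) / (c + 1)"
    have t: "0 < t" "t * (c + 1) = r \<bullet> r" using rr c0 by (simp_all add: t_def)
    have "t * c + t = r \<bullet> r" using t(2) by (simp only: distrib_left mult_1_right)
    then have "t * c < 2 * (r \<bullet> r)" using t(1) rr by linarith
    then have "t * (t * c) < t * (2 * (r \<bullet> r))" using t(1) by (intro mult_strict_left_mono)
    with q[of "- t"] show False by (simp add: power2_eq_square algebra_simps)
  qed
  then have "r \<bullet> r = 0" using inner_ge_zero[of r] by linarith
  then have "T w = \<mu> *\<^sub>R w" using r_def by simp
  then show ?thesis using that wS w1 min by blast
qed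

text \<open>The operator norm of \<open>T\<close> is the absolute value of an eigenvalue: the previous lemma, applied to
  \<open>- T \<circ> T\<close>, yields an eigenvalue \<open>r\<^sup>2\<close> of \<open>T \<circ> T\<close> that dominates its form, and then \<open>r\<close> or \<open>- r\<close> is an
  eigenvalue of \<open>T\<close>.\<close>

lemma self_adjoint_norm_eigenvector:
  fixes T :: "'a::euclidean_space \<Rightarrow> 'a"
  assumes T: "linear T" "\<And>x y. x \<bullet> T y = T x \<bullet> y"
  obtains w r where "w \<noteq> 0" "T w = r *\<^sub>R w" "\<And>y. norm (T y) \<le> \<bar>r\<bar> * norm y"
proof -
  interpret T: linear T by (rule T(1))
  have lin: "linear (\<lambda>y. - T (T y))"
    by (intro linearI) (simp_all add: T.add T.scaleR)
  have UNIV0: "(UNIV :: 'a set) \<noteq> {0}"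
    using nonzero_Basis nonempty_Basis by blast
  have adj: "x \<bullet> - T (T y) = - T (T x) \<bullet> y" for x y
    by (simp add: T(2))
  obtain w \<mu> where w: "norm w = 1" "- T (T w) = \<mu> *\<^sub>R w"
    and min: "\<And>y. \<mu> * (norm y)\<^sup>2 \<le> y \<bullet> - T (T y)"
    using self_adjoint_min_eigenvector[OF lin adj subspace_UNIV _ UNIV0] by auto
  have TT: "y \<bullet> T (T y) = (norm (T y))\<^sup>2" for y
    by (simp add: T(2) dot_square_norm)
  have "\<mu> \<le> 0"
  proof -
    have "w \<bullet> - T (T w) = \<mu>" using w by (simp add: dot_square_norm)
    then show ?thesis using TT[of w] by (metis inner_minus_right neg_le_0_iff_le zero_le_power2)
  qed
  define r where "r = sqrt (- \<mu>)"
  have r: "0 \<le> r" "r\<^sup>2 = - \<mu>" using \<open>\<mu> \<le> 0\<close> by (simp_all add: r_def)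
  have bound: "norm (T y) \<le> r * norm y" for y
  proof (rule power2_le_imp_le)
    show "(norm (T y))\<^sup>2 \<le> (r * norm y)\<^sup>2"
      using min[of y] TT[of y] r by (simp add: power_mult_distrib)
  qed (use r in simp)
  have w0: "w \<noteq> 0" using w by auto
  \<comment> \<open>\<open>T \<circ> T - r\<^sup>2\<close> factors, so either \<open>(T + r) w\<close> vanishes or it is an eigenvector for \<open>r\<close>.\<close>
  define z where "z = T w + r *\<^sub>R w"
  have Tz: "T z = r *\<^sub>R z"
  proof -
    have "T (T w) = (r * r) *\<^sub>R w" using w(2) r(2)
      by (metis minus_equation_iff power2_eq_square scaleR_minus_left)
    then show ?thesis by (simp add: z_def T.add T.scaleR scaleR_add_right)
  qed
  show thesis
  proof (cases "z = 0")
    case True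
    then have "T w = (- r) *\<^sub>R w" by (simp add: z_def eq_neg_iff_add_eq_0)
    then show thesis using that[of w "- r"] w0 bound r(1) by (metis abs_minus_cancel abs_of_nonneg)
  next
    case False
    then show thesis using that[of z r] Tz bound r(1) by (metis abs_of_nonneg)
  qed
qed

text \<open>This is the bound by \<open>1 / m\<close> for the pseudo-inverse of \<open>T\<close>, evaluated at \<open>T y\<close>. Only the component of
  \<open>y\<close> in the complement of the kernel contributes to either side, and there \<open>T\<close> expands by \<open>m\<close>.\<close>

lemma self_adjoint_gap_form_le:
  fixes T :: "'a::euclidean_space \<Rightarrow> 'a"
  assumes T: "linear T" "\<And>x y. x \<bullet> T y = T x \<bullet> y"
    and gap: "0 < m" "\<And>y. y \<in> {z. T z = 0}\<^sup>\<bottom> \<Longrightarrow> m * (norm y)\<^sup>2 \<le> y \<bullet> T y"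
  shows "y \<bullet> T y \<le> (norm (T y))\<^sup>2 / m"
proof -
  interpret T: linear T by (rule T(1))
  have sub: "subspace {z. T z = 0}" by (simp add: subspace_def T.add T.scaleR T.zero)
  obtain k s where ks: "y = k + s" "T k = 0" "s \<in> {z. T z = 0}\<^sup>\<bottom>"
    using subspace_sum_orthogonal_comp[OF sub] set_plus_elim[of y] by blast
  have Ty: "T y = T s" using ks by (simp add: T.add)
  have yTy: "y \<bullet> T y = s \<bullet> T s"
    using ks(2) T(2)[of k s] by (simp add: ks(1) T.add inner_add_left)
  have cs: "s \<bullet> T s \<le> norm s * norm (T s)" by (rule norm_cauchy_schwarz)
  have "m * (norm s)\<^sup>2 \<le> norm s * norm (T s)" using gap(2)[OF ks(3)] cs by simp
  then have "m * norm s \<le> norm (T s)"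
    by (cases "s = 0") (simp_all add: power2_eq_square)
  then have "norm s * norm (T s) \<le> norm (T s) / m * norm (T s)"
    using gap(1) by (intro mult_right_mono) (simp_all add: field_simps)
  then show ?thesis using cs yTy by (simp add: Ty power2_eq_square)
qed

text \<open>The Fredholm alternative in finite dimension. It supplies a preimage of the limit of the dual
  iterate.\<close>

lemma self_adjoint_range:
  fixes T :: "'a::euclidean_space \<Rightarrow> 'a"
  assumes T: "linear T" "\<And>x y. x \<bullet> T y = T x \<bullet> y"
  shows "range T = {z. T z = 0}\<^sup>\<bottom>"
proof -
  have "adjoint T = T" using T(2) by (intro adjoint_unique) simp
  then have "{z. T z = 0} = (range T)\<^sup>\<bottom>"
    using ker_orthogonal_comp_adjoint[OF T(1)] by auto
  then show ?thesis
    using orthogonal_comp_self[of "range T"] linear_subspace_image[OF T(1) subspace_UNIV] by simp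
qed

section \<open>The Laplacian acting on stacked vectors\<close>

text \<open>The action of the Kronecker product of \<open>A\<close> with an identity matrix; for real entries it is the
  matrix-vector product.\<close>

definition kron :: "real ^ 'n ^ 'n \<Rightarrow> 'a::real_vector ^ 'n \<Rightarrow> 'a ^ 'n" where
  "kron A X = (\<chi> i. \<Sum>j\<in>UNIV. A $ i $ j *\<^sub>R X $ j)"

lemma linear_kron: "linear (kron A)"
  by (intro linearI)
    (simp_all add: kron_def vec_eq_iff scaleR_add_right sum.distrib scaleR_sum_right mult.commute)

lemma kron_self_adjoint:
  fixes X Y :: "'a::real_inner ^ 'n"
  assumes "\<And>i j. A $ i $ j = A $ j $ i"
  shows "X \<bullet> kron A Y = kron A X \<bullet> Y"
proof -
  have "X \<bullet> kron A Y = (\<Sum>i\<in>UNIV. \<Sum>j\<in>UNIV. A $ i $ j * (X $ i \<bullet> Y $ j))"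
    by (simp add: kron_def inner_vec_def inner_sum_right)
  also have "\<dots> = (\<Sum>j\<in>UNIV. \<Sum>i\<in>UNIV. A $ i $ j * (X $ i \<bullet> Y $ j))"
    by (rule sum.swap)
  also have "\<dots> = (\<Sum>j\<in>UNIV. \<Sum>i\<in>UNIV. A $ j $ i * (X $ i \<bullet> Y $ j))"
    by (intro sum.cong refl) (metis assms)
  also have "\<dots> = kron A X \<bullet> Y"
    by (simp add: kron_def inner_vec_def inner_sum_left)
  finally show ?thesis .
qed

lemma kron_laplacian_nth:
  fixes X :: "'a::real_vector ^ 'n"
  shows "kron (laplacian a) X $ i = (\<Sum>j\<in>UNIV. a $ i $ j *\<^sub>R (X $ i - X $ j))"
proof -
  have "kron (laplacian a) X $ i =
      (\<Sum>j\<in>UNIV. (if i = j then (\<Sum>k\<in>UNIV. a $ i $ k) *\<^sub>R X $ j else 0) - a $ i $ j *\<^sub>R X $ j)"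
    unfolding kron_def laplacian_def
    by (simp, intro sum.cong refl) (simp add: scaleR_diff_left)
  also have "\<dots> = (\<Sum>k\<in>UNIV. a $ i $ k) *\<^sub>R X $ i - (\<Sum>j\<in>UNIV. a $ i $ j *\<^sub>R X $ j)"
    by (simp add: sum_subtractf)
  also have "\<dots> = (\<Sum>j\<in>UNIV. a $ i $ j *\<^sub>R (X $ i - X $ j))"
    by (simp add: scaleR_diff_right sum_subtractf scaleR_sum_left)
  finally show ?thesis .
qed

lemma laplacian_symmetric:
  assumes "weighted_undirected a"
  shows "laplacian a $ i $ j = laplacian a $ j $ i"
  using assms by (auto simp: laplacian_def weighted_undirected_def)

text \<open>Symmetrizing the double sum over the ordered pairs of vertices turns it into a sum over edges.\<close>

lemma laplacian_form:
  fixes X :: "'a::real_inner ^ 'n"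
  assumes a: "weighted_undirected a"
  shows "X \<bullet> kron (laplacian a) X =
    (\<Sum>i\<in>UNIV. \<Sum>j\<in>UNIV. a $ i $ j * (norm (X $ i - X $ j))\<^sup>2) / 2"
proof -
  let ?S = "\<Sum>i\<in>UNIV. \<Sum>j\<in>UNIV. a $ i $ j * (X $ i \<bullet> (X $ i - X $ j))"
  have sym: "a $ i $ j = a $ j $ i" for i j
    using a by (simp add: weighted_undirected_def)
  have S: "X \<bullet> kron (laplacian a) X = ?S"
    by (simp add: inner_vec_def kron_laplacian_nth inner_sum_right)
  have "?S = (\<Sum>j\<in>UNIV. \<Sum>i\<in>UNIV. a $ i $ j * (X $ i \<bullet> (X $ i - X $ j)))"
    by (rule sum.swap)
  also have "\<dots> = (\<Sum>i\<in>UNIV. \<Sum>j\<in>UNIV. a $ i $ j * (X $ j \<bullet> (X $ j - X $ i)))"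
    by (intro sum.cong refl) (metis sym)
  finally have "2 * ?S = (\<Sum>i\<in>UNIV. \<Sum>j\<in>UNIV.
      a $ i $ j * (X $ i \<bullet> (X $ i - X $ j)) + a $ i $ j * (X $ j \<bullet> (X $ j - X $ i)))"
    by (simp add: sum.distrib)
  also have "\<dots> = (\<Sum>i\<in>UNIV. \<Sum>j\<in>UNIV. a $ i $ j * (norm (X $ i - X $ j))\<^sup>2)"
    by (intro sum.cong refl)
      (simp add: dot_square_norm[symmetric] inner_diff_left inner_diff_right inner_commute algebra_simps)
  finally show ?thesis using S by simp
qed

lemma laplacian_form_nonneg:
  fixes X :: "'a::real_inner ^ 'n"
  assumes "weighted_undirected a"
  shows "0 \<le> X \<bullet> kron (laplacian a) X"
  unfolding laplacian_form[OF assms]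
  using assms by (auto simp: weighted_undirected_def intro!: sum_nonneg)

lemma laplacian_kernel:
  fixes X :: "'a::real_inner ^ 'n"
  assumes a: "weighted_undirected a" "graph_connected a"
  shows "kron (laplacian a) X = 0 \<longleftrightarrow> X \<in> range vec"
proof
  assume "kron (laplacian a) X = 0"
  then have "(\<Sum>i\<in>UNIV. \<Sum>j\<in>UNIV. a $ i $ j * (norm (X $ i - X $ j))\<^sup>2) = 0"
    using laplacian_form[OF a(1), of X] by simp
  moreover have nn: "0 \<le> a $ i $ j * (norm (X $ i - X $ j))\<^sup>2" for i j
    using a(1) by (simp add: weighted_undirected_def)
  ultimately have z: "a $ i $ j * (norm (X $ i - X $ j))\<^sup>2 = 0" for i j
    by (simp add: sum_nonneg_eq_0_iff sum_nonneg)
  have edge: "X $ i = X $ j" if "0 < a $ i $ j" for i j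
    using z[of i j] that by simp
  have "X $ i = X $ j" for i j
  proof -
    have "(i, j) \<in> {(i, j). 0 < a $ i $ j}\<^sup>*" using a(2) by (simp add: graph_connected_def)
    then show ?thesis by (induction rule: rtrancl_induct) (auto dest: edge)
  qed
  then have "X = vec (X $ undefined)" by (simp add: vec_eq_iff)
  then show "X \<in> range vec" by blast
next
  assume "X \<in> range vec"
  then show "kron (laplacian a) X = 0" by (auto simp: vec_eq_iff kron_laplacian_nth)
qed

text \<open>Any nonzero coordinate slice of a stacked eigenvector is an eigenvector of the matrix.\<close>

lemma kron_eigenvector_spectrum:
  fixes X :: "real ^ 'd ^ 'n"
  assumes "kron A X = r *\<^sub>R X" "X \<noteq> 0"
  shows "complex_of_real r \<in> spectrum A"
proof -
  obtain i c where ic: "X $ i $ c \<noteq> 0" using assms(2) by (auto simp: vec_eq_iff)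
  define w where "w = (\<chi> j. complex_of_real (X $ j $ c))"
  have "map_matrix complex_of_real A *v w = complex_of_real r *s w"
  proof -
    have "(\<Sum>j\<in>UNIV. A $ k $ j * X $ j $ c) = r * X $ k $ c" for k
      using arg_cong[OF assms(1), of "\<lambda>Y. Y $ k $ c"] by (simp add: kron_def)
    then have "(\<Sum>j\<in>UNIV. complex_of_real (A $ k $ j) * complex_of_real (X $ j $ c))
        = complex_of_real r * complex_of_real (X $ k $ c)" for k
      by (simp flip: of_real_mult of_real_sum)
    then show ?thesis
      by (simp add: vec_eq_iff matrix_vector_mult_def map_matrix_def w_def)
  qed
  moreover have "w \<noteq> 0" using ic by (auto simp: w_def vec_eq_iff)
  ultimately show ?thesis unfolding spectrum_def by blast
qed

text \<open>For real symmetric matrices the complex eigenvalues are real: comparing the two forms in the real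
  and imaginary part of an eigenvector forces \<open>Im z = 0\<close>, and then one of the two parts is a real
  eigenvector.\<close>

lemma symmetric_spectrumE:
  fixes A :: "real ^ 'n ^ 'n"
  assumes sym: "\<And>i j. A $ i $ j = A $ j $ i" and z: "z \<in> spectrum A"
  obtains r and w :: "real ^ 'n" where "z = complex_of_real r" "w \<noteq> 0" "kron A w = r *\<^sub>R w"
proof -
  obtain u where u: "u \<noteq> 0" "map_matrix complex_of_real A *v u = z *s u"
    using z by (auto simp: spectrum_def)
  define p where "p = (\<chi> i. Re (u $ i))"
  define q where "q = (\<chi> i. Im (u $ i))"
  have eq: "(\<Sum>j\<in>UNIV. complex_of_real (A $ i $ j) * u $ j) = z * u $ i" for i
    using arg_cong[OF u(2), of "\<lambda>y. y $ i"] by (simp add: matrix_vector_mult_def map_matrix_def)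
  have p: "kron A p = Re z *\<^sub>R p - Im z *\<^sub>R q"
    using arg_cong[OF eq, of Re] by (simp add: vec_eq_iff kron_def p_def q_def)
  have q: "kron A q = Re z *\<^sub>R q + Im z *\<^sub>R p"
    using arg_cong[OF eq, of Im] by (simp add: vec_eq_iff kron_def p_def q_def)
  have pq: "p \<noteq> 0 \<or> q \<noteq> 0"
    using u(1) by (auto simp: p_def q_def vec_eq_iff complex_eq_iff)
  have "Im z * (p \<bullet> p) + Im z * (q \<bullet> q) = 0"
    using kron_self_adjoint[OF sym, of p q] inner_commute[of p q] unfolding p q
    by (simp add: inner_diff_left inner_right_distrib)
  then have "Im z * (p \<bullet> p + q \<bullet> q) = 0" by (simp add: algebra_simps)
  moreover have "p \<bullet> p + q \<bullet> q > 0"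
    using pq by (metis add_nonneg_pos add_pos_nonneg inner_ge_zero inner_gt_zero_iff)
  ultimately have im: "Im z = 0" by simp
  then have z: "z = complex_of_real (Re z)" by (simp add: complex_eq_iff)
  show thesis
    using pq that[OF z, of p] that[OF z, of q] p q im by auto
qed

text \<open>Eigenvectors for different eigenvalues are orthogonal, hence independent. Finiteness is what
  makes the maximum and the minimum in the two spectral constants comparable to the members of their
  sets.\<close>

lemma finite_symmetric_spectrum:
  fixes A :: "real ^ 'n ^ 'n"
  assumes sym: "\<And>i j. A $ i $ j = A $ j $ i"
  shows "finite (spectrum A)"
proof -
  define R where "R = {r. \<exists>w :: real ^ 'n. w \<noteq> 0 \<and> kron A w = r *\<^sub>R w}"
  define e where "e r = (SOME w :: real ^ 'n. w \<noteq> 0 \<and> kron A w = r *\<^sub>R w)" for r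
  have e: "e r \<noteq> 0" "kron A (e r) = r *\<^sub>R e r" if "r \<in> R" for r
    using someI_ex[of "\<lambda>w :: real ^ 'n. w \<noteq> 0 \<and> kron A w = r *\<^sub>R w"] that
    by (auto simp: R_def e_def)
  have orth: "e r \<bullet> e s = 0" if rs: "r \<in> R" "s \<in> R" "r \<noteq> s" for r s
  proof -
    have "s * (e r \<bullet> e s) = r * (e r \<bullet> e s)"
      using kron_self_adjoint[OF sym, of "e r" "e s"] e rs by simp
    then show ?thesis using rs(3) by simp
  qed
  have inj: "inj_on e R"
    using orth e(1) by (intro inj_onI) (metis inner_eq_zero_iff)
  have "pairwise orthogonal (e ` R)"
    using orth by (auto simp: pairwise_def orthogonal_def)
  moreover have "0 \<notin> e ` R" using e(1) by force
  ultimately have "independent (e ` R)" by (rule pairwise_orthogonal_independent)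
  then have "finite (e ` R)" using independent_bound by blast
  then have "finite R" using inj by (simp add: finite_image_iff)
  moreover have "spectrum A \<subseteq> complex_of_real ` R"
    using symmetric_spectrumE[OF sym] unfolding R_def by blast
  ultimately show ?thesis using finite_surj by blast
qed

lemma norm_kron_le_spectral_radius:
  fixes X :: "real ^ 'd ^ 'n"
  assumes sym: "\<And>i j. A $ i $ j = A $ j $ i"
  shows "norm (kron A X) \<le> spectral_radius A * norm X"
proof -
  obtain w :: "real ^ 'd ^ 'n" and r where w: "w \<noteq> 0" "kron A w = r *\<^sub>R w"
    and bound: "\<And>y :: real ^ 'd ^ 'n. norm (kron A y) \<le> \<bar>r\<bar> * norm y"
    using self_adjoint_norm_eigenvector[OF linear_kron kron_self_adjoint[OF sym]] by blast
  have "cmod (complex_of_real r) \<le> spectral_radius A"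
    unfolding spectral_radius_def
    using finite_symmetric_spectrum[OF sym] kron_eigenvector_spectrum[OF w(2,1)]
    by (intro Max_ge finite_imageI imageI)
  then have "\<bar>r\<bar> * norm X \<le> spectral_radius A * norm X"
    by (intro mult_right_mono) auto
  then show ?thesis using bound[of X] by linarith
qed

lemma finite_real_spectrum:
  assumes "finite (spectrum A)"
  shows "finite {r. r \<noteq> 0 \<and> complex_of_real r \<in> spectrum A}"
  by (rule finite_subset[OF _ finite_imageI[OF assms, of Re]]) force

text \<open>The least value of the Rayleigh quotient on the complement of the kernel is a nonzero eigenvalue,
  hence at least the least one. The second part needs a nonzero vector in that complement as a
  witness that nonzero eigenvalues exist at all.\<close>

lemma laplacian_spectral_gap:
  fixes a :: "real ^ 'n ^ 'n" and X :: "real ^ 'd ^ 'n"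
  assumes a: "weighted_undirected a" "graph_connected a"
    and X: "X \<in> {z. kron (laplacian a) z = 0}\<^sup>\<bottom>"
  shows "least_nonzero_eigenvalue (laplacian a) * (norm X)\<^sup>2 \<le> X \<bullet> kron (laplacian a) X"
    and "X \<noteq> 0 \<Longrightarrow> 0 < least_nonzero_eigenvalue (laplacian a)"
proof -
  let ?T = "kron (laplacian a) :: real ^ 'd ^ 'n \<Rightarrow> real ^ 'd ^ 'n"
  let ?S = "{z. ?T z = 0}\<^sup>\<bottom>"
  let ?R = "{r. r \<noteq> 0 \<and> complex_of_real r \<in> spectrum (laplacian a)}"
  note sym = laplacian_symmetric[OF a(1)]
  note adj = kron_self_adjoint[OF sym]
  have fin: "finite ?R" by (intro finite_real_spectrum finite_symmetric_spectrum sym)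
  have inv: "?T ` ?S \<subseteq> ?S"
    using adj[where 'a = "real ^ 'd"]
    by (auto simp: orthogonal_comp_def orthogonal_def)
  have "least_nonzero_eigenvalue (laplacian a) * (norm X)\<^sup>2 \<le> X \<bullet> ?T X
      \<and> 0 < least_nonzero_eigenvalue (laplacian a)" if "X \<noteq> 0"
  proof -
    have S0: "?S \<noteq> {0}" using X that by blast
    obtain w \<mu> where w: "w \<in> ?S" "norm w = 1" "?T w = \<mu> *\<^sub>R w"
      and min: "\<And>y. y \<in> ?S \<Longrightarrow> \<mu> * (norm y)\<^sup>2 \<le> y \<bullet> ?T y"
      using self_adjoint_min_eigenvector[OF linear_kron adj subspace_orthogonal_comp inv S0] by blast
    have w0: "w \<noteq> 0" using w(2) by auto
    have "\<mu> \<noteq> 0"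
    proof
      assume "\<mu> = 0"
      then have "w \<bullet> w = 0" using w(1,3) by (auto simp: orthogonal_comp_def orthogonal_def)
      then show False using w0 by simp
    qed
    then have \<mu>: "\<mu> \<in> ?R" using kron_eigenvector_spectrum[OF w(3) w0] by simp
    have "least_nonzero_eigenvalue (laplacian a) \<le> \<mu>"
      unfolding least_nonzero_eigenvalue_def using fin \<mu> by (rule Min_le)
    then have "least_nonzero_eigenvalue (laplacian a) * (norm X)\<^sup>2 \<le> \<mu> * (norm X)\<^sup>2"
      by (intro mult_right_mono) auto
    moreover have "0 < least_nonzero_eigenvalue (laplacian a)"
    proof -
      have "least_nonzero_eigenvalue (laplacian a) \<in> ?R"
        unfolding least_nonzero_eigenvalue_def using fin \<mu> by (intro Min_in) auto
      then obtain r and y :: "real ^ 'n" where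
        r: "complex_of_real (least_nonzero_eigenvalue (laplacian a)) = complex_of_real r"
          "least_nonzero_eigenvalue (laplacian a) \<noteq> 0"
        and y: "y \<noteq> 0" "kron (laplacian a) y = r *\<^sub>R y"
        using symmetric_spectrumE[OF sym] by blast
      have "0 \<le> r * (y \<bullet> y)" using laplacian_form_nonneg[OF a(1), of y] y by simp
      moreover have "0 < y \<bullet> y" using y(1) by simp
      ultimately have "0 \<le> r" by (metis zero_le_mult_iff not_le)
      then show ?thesis using r by simp
    qed
    ultimately show ?thesis using min[OF X] by linarith
  qed
  then show "least_nonzero_eigenvalue (laplacian a) * (norm X)\<^sup>2 \<le> X \<bullet> ?T X"
    "X \<noteq> 0 \<Longrightarrow> 0 < least_nonzero_eigenvalue (laplacian a)"
    by (cases "X = 0"; simp)+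
qed

text \<open>With two vertices or more, not every stacked vector is a consensus vector.\<close>

lemma exists_disagreement:
  fixes a :: "real ^ 'n ^ 'n"
  assumes a: "weighted_undirected a" "graph_connected a" and card: "2 \<le> CARD('n)"
  obtains X :: "real ^ 'd ^ 'n" where "X \<in> {z. kron (laplacian a) z = 0}\<^sup>\<bottom>" "X \<noteq> 0"
proof (rule ccontr)
  let ?K = "{z :: real ^ 'd ^ 'n. kron (laplacian a) z = 0}"
  interpret T: linear "kron (laplacian a) :: real ^ 'd ^ 'n \<Rightarrow> _" by (rule linear_kron)
  assume "\<not> thesis"
  then have "?K\<^sup>\<bottom> = {0}"
    using that subspace_0[OF subspace_orthogonal_comp[of ?K]] by blast
  moreover have "subspace ?K" by (simp add: subspace_def T.add T.scaleR T.zero)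
  ultimately have K: "?K = UNIV" using orthogonal_comp_self[of ?K] by simp
  obtain i j :: 'n where ij: "i \<noteq> j"
    using card by (metis (full_types) UNIV_I card_2_iff' ex_card)
  have "axis i 1 \<in> ?K" using K by blast
  then obtain c :: "real ^ 'd" where c: "axis i 1 = vec c"
    using laplacian_kernel[OF a, of "axis i (1 :: real ^ 'd)"] by blast
  have "axis i (1 :: real ^ 'd) $ i = axis i 1 $ j" unfolding c by simp
  then show False using ij by (simp add: axis_def)
qed

section \<open>Gradients, minimizers and stacked gradients\<close>

lemma grad_eqI:
  fixes f :: "'a::real_inner \<Rightarrow> real"
  assumes "GDERIV f x :> D"
  shows "grad f x = D"
  unfolding grad_def
proof (rule the_equality)
  show "GDERIV f x :> D" by (rule assms)
next
  fix D' assume "GDERIV f x :> D'"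
  then have "(\<lambda>h. h \<bullet> D') = (\<lambda>h. h \<bullet> D)"
    using assms unfolding gderiv_def by (rule has_derivative_unique)
  then show "D' = D" by (simp add: fun_eq_iff vector_eq_ldot)
qed

lemma GDERIV_grad:
  fixes f :: "'a::euclidean_space \<Rightarrow> real"
  assumes "f differentiable (at x)"
  shows "GDERIV f x :> grad f x"
proof -
  obtain f' where f': "(f has_derivative f') (at x)" using assms by (auto simp: differentiable_def)
  have "f' = (\<lambda>h. h \<bullet> adjoint f' 1)"
    using adjoint_works[OF has_derivative_linear[OF f'], of _ 1] by simp
  then have "GDERIV f x :> adjoint f' 1" using f' by (simp add: gderiv_def)
  then show ?thesis using grad_eqI by metis
qed

lemma grad_sum:
  fixes f :: "'i \<Rightarrow> 'a::euclidean_space \<Rightarrow> real"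
  assumes "\<And>i. f i differentiable (at x)"
  shows "grad (\<lambda>x. \<Sum>i\<in>I. f i x) x = (\<Sum>i\<in>I. grad (f i) x)"
proof (rule grad_eqI)
  show "GDERIV (\<lambda>x. \<Sum>i\<in>I. f i x) x :> (\<Sum>i\<in>I. grad (f i) x)"
    using GDERIV_grad[OF assms] unfolding gderiv_def inner_sum_right
    by (intro has_derivative_sum)
qed

definition stacked_grad :: "('n \<Rightarrow> 'a::real_inner \<Rightarrow> real) \<Rightarrow> 'a ^ 'n \<Rightarrow> 'a ^ 'n" where
  "stacked_grad f X = (\<chi> i. grad (f i) (X $ i))"

lemma grad_separable:
  fixes f :: "'n::finite \<Rightarrow> 'a::euclidean_space \<Rightarrow> real"
  assumes "\<And>i z. f i differentiable (at z)"
  shows "grad (\<lambda>X. \<Sum>i\<in>UNIV. f i (X $ i)) X = stacked_grad f X"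
proof (rule grad_eqI)
  have "((\<lambda>X. f i (X $ i)) has_derivative (\<lambda>h. h $ i \<bullet> grad (f i) (X $ i))) (at X)" for i
    using has_derivative_compose[OF bounded_linear_imp_has_derivative[OF bounded_linear_vec_nth]
        GDERIV_grad[OF assms, unfolded gderiv_def]] .
  then have "((\<lambda>X. \<Sum>i\<in>UNIV. f i (X $ i)) has_derivative
      (\<lambda>h. \<Sum>i\<in>UNIV. h $ i \<bullet> grad (f i) (X $ i))) (at X)"
    by (intro has_derivative_sum)
  then show "GDERIV (\<lambda>X. \<Sum>i\<in>UNIV. f i (X $ i)) X :> stacked_grad f X"
    by (simp add: gderiv_def inner_vec_def stacked_grad_def)
qed

lemma grad_argmin:
  fixes f :: "'a::euclidean_space \<Rightarrow> real"
  assumes "z \<in> argmin_set f" "f differentiable (at z)"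
  shows "grad f z = 0"
proof -
  have min: "f z \<le> f y" for y
    using assms(1) by (auto simp: argmin_set_def is_arg_min_def not_less)
  have "(\<lambda>h. h \<bullet> grad f z) = (\<lambda>h. 0)"
    using GDERIV_grad[OF assms(2)] min unfolding gderiv_def
    by (intro differential_zero_maxmin[of z UNIV f]) auto
  then have "grad f z \<bullet> grad f z = 0" by metis
  then show ?thesis by simp
qed

lemma closed_argmin:
  fixes f :: "'a::topological_space \<Rightarrow> real"
  assumes "continuous_on UNIV f"
  shows "closed (argmin_set f)"
proof -
  have "argmin_set f = (\<Inter>y. {x. f x \<le> f y})"
    by (auto simp: argmin_set_def is_arg_min_def not_less)
  also have "closed \<dots>"
    using assms by (intro closed_INT ballI closed_Collect_le) auto
  finally show ?thesis .
qed

lemma norm_vec_sq: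
  fixes X :: "'a::real_normed_vector ^ 'n"
  shows "(norm X)\<^sup>2 = (\<Sum>i\<in>UNIV. (norm (X $ i))\<^sup>2)"
  by (simp add: norm_vec_def L2_set_def sum_nonneg)

lemma norm_stacked_grad_diff_le:
  assumes "\<And>i y z. norm (grad (f i) y - grad (f i) z) \<le> K i * norm (y - z)"
    and "\<And>i. 0 \<le> K i" "\<And>i. K i \<le> L"
  shows "norm (stacked_grad f X - stacked_grad f Y) \<le> L * norm (X - Y)"
proof (rule power2_le_imp_le)
  have L: "0 \<le> L" using assms(2,3) order_trans by blast
  have "(norm (stacked_grad f X - stacked_grad f Y))\<^sup>2
      = (\<Sum>i\<in>UNIV. (norm (grad (f i) (X $ i) - grad (f i) (Y $ i)))\<^sup>2)"
    by (simp add: norm_vec_sq stacked_grad_def)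
  also have "\<dots> \<le> (\<Sum>i\<in>UNIV. (L * norm (X $ i - Y $ i))\<^sup>2)"
  proof (intro sum_mono power_mono)
    fix i
    show "norm (grad (f i) (X $ i) - grad (f i) (Y $ i)) \<le> L * norm (X $ i - Y $ i)"
      using assms(1)[of i "X $ i" "Y $ i"] mult_right_mono[OF assms(3)[of i] norm_ge_zero, of "X $ i - Y $ i"]
      by linarith
  qed simp
  also have "\<dots> = (L * norm (X - Y))\<^sup>2"
    by (simp add: power_mult_distrib norm_vec_sq sum_distrib_left)
  finally show "(norm (stacked_grad f X - stacked_grad f Y))\<^sup>2 \<le> (L * norm (X - Y))\<^sup>2" .
  show "0 \<le> L * norm (X - Y)" using L by simp
qed

section \<open>Consensus and the restricted secant inequality on stacked vectors\<close>

lemma norm_add_squared: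
  fixes a b :: "'a::real_inner"
  shows "(norm (a + b))\<^sup>2 = (norm a)\<^sup>2 + 2 * (a \<bullet> b) + (norm b)\<^sup>2"
  by (simp add: power2_norm_eq_inner inner_left_distrib inner_right_distrib inner_commute[of b a])

definition mean :: "'a::real_vector ^ 'n \<Rightarrow> 'a" where
  "mean X = (\<Sum>i\<in>UNIV. X $ i) /\<^sub>R real CARD('n)"

lemma inner_vec_left:
  fixes Y :: "'a::real_inner ^ 'n"
  shows "vec c \<bullet> Y = c \<bullet> (\<Sum>i\<in>UNIV. Y $ i)"
  by (simp add: inner_vec_def inner_sum_right)

lemma sum_deviation_zero:
  fixes X :: "'a::real_vector ^ 'n"
  shows "(\<Sum>i\<in>UNIV. (X - vec (mean X)) $ i) = 0"
  by (simp add: mean_def sum_subtractf sum_constant_scaleR)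

lemma norm_vec_vec:
  fixes c :: "'a::real_inner"
  shows "(norm (vec c :: 'a ^ 'n))\<^sup>2 = real CARD('n) * (norm c)\<^sup>2"
  by (simp add: norm_vec_sq)

lemma vec_minus_vec: "vec a - vec b = (vec (a - b) :: 'a::real_inner ^ 'n)"
  by (simp add: vec_eq_iff)

text \<open>Pythagoras: the deviations from the mean add up to zero, so they are orthogonal to consensus.\<close>

lemma consensus_decomposition:
  fixes X :: "'a::real_inner ^ 'n"
  shows "(norm (X - vec c))\<^sup>2 = (norm (X - vec (mean X)))\<^sup>2 + real CARD('n) * (norm (mean X - c))\<^sup>2"
proof -
  have split: "X - vec c = vec (mean X - c) + (X - vec (mean X))" by (simp add: vec_eq_iff)
  have orth: "vec (mean X - c) \<bullet> (X - vec (mean X)) = 0"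
    by (simp only: inner_vec_left sum_deviation_zero inner_zero_right)
  show ?thesis
    by (subst split) (simp only: norm_add_squared orth norm_vec_vec mult_zero_right add_0_right add.commute)
qed

lemma closed_vec_image:
  fixes S :: "'a::euclidean_space set"
  assumes "closed S"
  shows "closed (vec ` S :: ('a ^ 'n) set)"
  by (rule closed_injective_linear_image[OF assms linear_vec]) (simp add: inj_def)

text \<open>By the decomposition, the distance to a consensus vector depends on that vector only through its
  distance to the mean.\<close>

lemma closest_point_consensus:
  fixes S :: "'a::euclidean_space set" and X :: "'a ^ 'n"
  assumes S: "closed S" "convex S" "S \<noteq> {}"
  shows "closest_point (vec ` S) X = vec (closest_point S (mean X))"
proof (rule closest_point_unique[symmetric])
  let ?c = "closest_point S (mean X)"
  show "convex (vec ` S :: ('a ^ 'n) set)"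
    by (rule convex_linear_image[OF linear_vec S(2)])
  show "closed (vec ` S :: ('a ^ 'n) set)" by (rule closed_vec_image[OF S(1)])
  show "vec ?c \<in> vec ` S" using closest_point_in_set[OF S(1,3)] by blast
  show "\<forall>Z\<in>vec ` S. dist X (vec ?c) \<le> dist X Z"
  proof
    fix Z :: "'a ^ 'n" assume "Z \<in> vec ` S"
    then obtain z where z: "Z = vec z" "z \<in> S" by blast
    have "norm (mean X - ?c) \<le> norm (mean X - z)"
      using closest_point_le[OF S(1) z(2), of "mean X"] by (simp add: dist_norm)
    then have "real CARD('n) * (norm (mean X - ?c))\<^sup>2 \<le> real CARD('n) * (norm (mean X - z))\<^sup>2"
      by (intro mult_left_mono power_mono) auto
    then have "(norm (X - vec ?c))\<^sup>2 \<le> (norm (X - vec z))\<^sup>2"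
      by (simp only: consensus_decomposition[of X ?c] consensus_decomposition[of X z])
    then show "dist X (vec ?c) \<le> dist X Z"
      unfolding dist_norm z(1) by (rule power2_le_imp_le) simp
  qed
qed

text \<open>The deviation \<open>X - vec c\<close> splits orthogonally into a consensus part \<open>s\<close>, on which the secant inequality
  of the sum acts, and a disagreement part \<open>y\<close>, on which the quadratic form \<open>Q\<close> of the Laplacian acts.
  The remaining contributions of the gradients are controlled by the Lipschitz constant, and \<open>\<alpha>\<close> has to
  be large enough for the gap to outweigh them.\<close>

lemma restricted_secant_stacked:
  fixes f :: "'n::finite \<Rightarrow> 'a::euclidean_space \<Rightarrow> real" and X :: "'a ^ 'n"
  assumes n: "n = real CARD('n)" and \<nu>: "0 < \<nu>" and \<alpha>: "0 \<le> \<alpha>" and K: "0 \<le> K"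
    and lip: "\<And>X Y. norm (stacked_grad f X - stacked_grad f Y) \<le> K * norm (X - Y)"
    and secant: "\<nu> * (norm (mean X - c))\<^sup>2
      \<le> ((\<Sum>i\<in>UNIV. grad (f i) (mean X)) - (\<Sum>i\<in>UNIV. grad (f i) c)) \<bullet> (mean X - c)"
    and gap: "m * (norm (X - vec (mean X)))\<^sup>2 \<le> Q"
  shows "min (\<nu> / (2 * n)) (\<alpha> * m - (2 * n * K\<^sup>2 + \<nu> * K) / \<nu>) * (norm (X - vec c))\<^sup>2
    \<le> \<alpha> * Q + (X - vec c) \<bullet> (stacked_grad f X - stacked_grad f (vec c))"
proof -
  let ?\<Phi> = "stacked_grad f" and ?m = "mean X"
  define y where "y = X - vec ?m"
  define s where "s = (vec (?m - c) :: 'a ^ 'n)"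
  define P where "P = ?\<Phi> X - ?\<Phi> (vec ?m)"
  define R where "R = ?\<Phi> (vec ?m) - ?\<Phi> (vec c)"
  define a where "a = norm s"
  define b where "b = norm y"
  have n0: "0 < n" by (simp add: n)
  have a2: "a\<^sup>2 = n * (norm (?m - c))\<^sup>2" by (simp add: a_def s_def norm_vec_vec n)
  have nP: "norm P \<le> K * b" using lip[of X "vec ?m"] by (simp add: P_def b_def y_def)
  have nR: "norm R \<le> K * a"
    using lip[of "vec ?m" "vec c"] by (simp add: R_def a_def s_def vec_minus_vec)
  have ab: "0 \<le> a" "0 \<le> b" by (simp_all add: a_def b_def)
  have lower: "- (norm u * norm w) \<le> u \<bullet> w" for u w :: "'a ^ 'n"
    using Cauchy_Schwarz_ineq2[of u w] by simp
  have sR: "\<nu> / n * a\<^sup>2 \<le> s \<bullet> R"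
  proof -
    have "s \<bullet> R = (?m - c) \<bullet> ((\<Sum>i\<in>UNIV. grad (f i) ?m) - (\<Sum>i\<in>UNIV. grad (f i) c))"
      by (simp add: s_def inner_vec_left R_def stacked_grad_def sum_subtractf)
    then show ?thesis using secant n0 by (simp add: a2 inner_commute)
  qed
  have yR: "- (b * (K * a)) \<le> y \<bullet> R"
    using lower[of y R] mult_left_mono[OF nR ab(2)] by (simp add: b_def)
  have sP: "- (a * (K * b)) \<le> s \<bullet> P"
    using lower[of s P] mult_left_mono[OF nP ab(1)] by (simp add: a_def)
  have yP: "- (b * (K * b)) \<le> y \<bullet> P"
    using lower[of y P] mult_left_mono[OF nP ab(2)] by (simp add: b_def)
  have X: "X - vec c = s + y" by (simp add: s_def y_def vec_eq_iff)
  have split: "(X - vec c) \<bullet> (?\<Phi> X - ?\<Phi> (vec c)) = s \<bullet> P + y \<bullet> P + s \<bullet> R + y \<bullet> R"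
  proof -
    have "?\<Phi> X - ?\<Phi> (vec c) = P + R" by (simp add: P_def R_def)
    then show ?thesis unfolding X by (simp only: inner_left_distrib inner_right_distrib)
  qed
  \<comment> \<open>The two mixed terms are paid for with half of the secant term.\<close>
  have young: "2 * K * a * b \<le> \<nu> / (2 * n) * a\<^sup>2 + 2 * n * K\<^sup>2 / \<nu> * b\<^sup>2"
  proof -
    have "0 \<le> (\<nu> * a - 2 * n * K * b)\<^sup>2 / (2 * n * \<nu>)"
      using n0 \<nu> by simp
    also have "\<dots> = \<nu> / (2 * n) * a\<^sup>2 + 2 * n * K\<^sup>2 / \<nu> * b\<^sup>2 - 2 * K * a * b"
      using n0 \<nu> by (simp add: power2_eq_square field_simps)
    finally show ?thesis by simp
  qed
  have gap': "\<alpha> * (m * b\<^sup>2) \<le> \<alpha> * Q"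
    using gap \<alpha> by (intro mult_left_mono) (simp_all add: b_def y_def)
  have norm: "(norm (X - vec c))\<^sup>2 = a\<^sup>2 + b\<^sup>2"
    by (simp add: consensus_decomposition[of X c] a2 n b_def y_def)
  let ?\<mu> = "min (\<nu> / (2 * n)) (\<alpha> * m - (2 * n * K\<^sup>2 + \<nu> * K) / \<nu>)"
  have "?\<mu> * (a\<^sup>2 + b\<^sup>2) \<le> \<nu> / (2 * n) * a\<^sup>2 + (\<alpha> * m - (2 * n * K\<^sup>2 + \<nu> * K) / \<nu>) * b\<^sup>2"
    unfolding distrib_left by (intro add_mono mult_right_mono) auto
  also have "\<dots> = \<nu> / n * a\<^sup>2 - (\<nu> / (2 * n) * a\<^sup>2 + 2 * n * K\<^sup>2 / \<nu> * b\<^sup>2) + \<alpha> * (m * b\<^sup>2) - b * (K * b)"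
    using \<nu> n0 by (simp add: field_simps power2_eq_square)
  also have "\<dots> \<le> \<alpha> * Q + (s \<bullet> P + y \<bullet> P + s \<bullet> R + y \<bullet> R)"
  proof -
    have "b * (K * a) + a * (K * b) = 2 * K * a * b" by simp
    then show ?thesis using young gap' sR yR sP yP by linarith
  qed
  finally show ?thesis unfolding split norm .
qed

section \<open>Square integrable vectors and conditionally centred noise\<close>

text \<open>The class in which the iterates live. It is closed under the operations of the algorithm, and
  products of its members are integrable, which justifies each splitting of an expectation.\<close>

definition square_integrable :: "'w measure \<Rightarrow> ('w \<Rightarrow> 'a::euclidean_space) \<Rightarrow> bool" where
  "square_integrable M f \<longleftrightarrow> f \<in> borel_measurable M \<and> integrable M (\<lambda>\<omega>. (norm (f \<omega>))\<^sup>2)"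

lemma square_integrable_measurable: "square_integrable M f \<Longrightarrow> f \<in> borel_measurable M"
  by (simp add: square_integrable_def)

lemma square_integrable_bound:
  fixes f :: "'w \<Rightarrow> 'a::euclidean_space" and g :: "'w \<Rightarrow> 'b::euclidean_space"
  assumes g: "square_integrable M g" and f: "f \<in> borel_measurable M"
    and le: "\<And>\<omega>. \<omega> \<in> space M \<Longrightarrow> norm (f \<omega>) \<le> c * norm (g \<omega>)"
  shows "square_integrable M f"
  unfolding square_integrable_def
proof
  have "integrable M (\<lambda>\<omega>. c\<^sup>2 * (norm (g \<omega>))\<^sup>2)"
    using g by (simp add: square_integrable_def)
  then show "integrable M (\<lambda>\<omega>. (norm (f \<omega>))\<^sup>2)"
  proof (rule Bochner_Integration.integrable_bound)
    show "(\<lambda>\<omega>. (norm (f \<omega>))\<^sup>2) \<in> borel_measurable M" using f by measurable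
    show "AE \<omega> in M. norm ((norm (f \<omega>))\<^sup>2) \<le> norm (c\<^sup>2 * (norm (g \<omega>))\<^sup>2)"
    proof (rule AE_I2)
      fix \<omega> assume "\<omega> \<in> space M"
      then have "(norm (f \<omega>))\<^sup>2 \<le> (c * norm (g \<omega>))\<^sup>2" using le by (intro power_mono) auto
      then show "norm ((norm (f \<omega>))\<^sup>2) \<le> norm (c\<^sup>2 * (norm (g \<omega>))\<^sup>2)"
        by (simp add: power_mult_distrib)
    qed
  qed
qed (rule f)

lemma square_integrable_add:
  assumes f: "square_integrable M f" and g: "square_integrable M g"
  shows "square_integrable M (\<lambda>\<omega>. f \<omega> + g \<omega>)"
  unfolding square_integrable_def
proof
  show m: "(\<lambda>\<omega>. f \<omega> + g \<omega>) \<in> borel_measurable M"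
    using f g by (intro borel_measurable_add square_integrable_measurable)
  have "integrable M (\<lambda>\<omega>. 2 * (norm (f \<omega>))\<^sup>2 + 2 * (norm (g \<omega>))\<^sup>2)"
    using f g by (simp add: square_integrable_def)
  then show "integrable M (\<lambda>\<omega>. (norm (f \<omega> + g \<omega>))\<^sup>2)"
  proof (rule Bochner_Integration.integrable_bound)
    show "(\<lambda>\<omega>. (norm (f \<omega> + g \<omega>))\<^sup>2) \<in> borel_measurable M" using m by measurable
    show "AE \<omega> in M. norm ((norm (f \<omega> + g \<omega>))\<^sup>2) \<le> norm (2 * (norm (f \<omega>))\<^sup>2 + 2 * (norm (g \<omega>))\<^sup>2)"
    proof (rule AE_I2)
      fix \<omega>
      have "(norm (f \<omega> + g \<omega>))\<^sup>2 \<le> (norm (f \<omega>) + norm (g \<omega>))\<^sup>2"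
        by (intro power_mono norm_triangle_ineq) simp
      also have "\<dots> \<le> 2 * (norm (f \<omega>))\<^sup>2 + 2 * (norm (g \<omega>))\<^sup>2"
        using sum_squares_bound[of "norm (f \<omega>)" "norm (g \<omega>)"] by (simp add: power2_sum)
      finally show "norm ((norm (f \<omega> + g \<omega>))\<^sup>2) \<le> norm (2 * (norm (f \<omega>))\<^sup>2 + 2 * (norm (g \<omega>))\<^sup>2)"
        by simp
    qed
  qed
qed

lemma square_integrable_linear:
  assumes f: "square_integrable M f" and T: "linear T"
  shows "square_integrable M (\<lambda>\<omega>. T (f \<omega>))"
proof -
  have bl: "bounded_linear T" by (rule linear_conv_bounded_linear[THEN iffD1, OF T])
  obtain B where B: "\<forall>x. norm (T x) \<le> norm x * B" using bounded_linear.bounded[OF bl] ..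
  show ?thesis
  proof (rule square_integrable_bound[OF f])
    show "(\<lambda>\<omega>. T (f \<omega>)) \<in> borel_measurable M"
      by (rule borel_measurable_continuous_on[OF linear_continuous_on[OF bl] square_integrable_measurable[OF f]])
    show "norm (T (f \<omega>)) \<le> B * norm (f \<omega>)" for \<omega>
      using spec[OF B, of "f \<omega>"] by (simp only: mult.commute)
  qed
qed

lemma square_integrable_scaleR:
  assumes "square_integrable M f"
  shows "square_integrable M (\<lambda>\<omega>. c *\<^sub>R f \<omega>)"
  using assms by (rule square_integrable_linear) (simp add: linear_iff scaleR_add_right)

lemma square_integrable_diff:
  assumes f: "square_integrable M f" and g: "square_integrable M g"
  shows "square_integrable M (\<lambda>\<omega>. f \<omega> - g \<omega>)"
  using square_integrable_add[OF f square_integrable_scaleR[OF g, of "- 1"]] by simp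

lemma square_integrable_const:
  assumes "finite_measure M"
  shows "square_integrable M (\<lambda>\<omega>. c)"
  using assms by (simp add: square_integrable_def finite_measure.integrable_const)

lemma square_integrable_inner:
  assumes f: "square_integrable M f" and g: "square_integrable M g"
  shows "integrable M (\<lambda>\<omega>. f \<omega> \<bullet> g \<omega>)"
proof (rule Bochner_Integration.integrable_bound)
  show "integrable M (\<lambda>\<omega>. (norm (f \<omega>))\<^sup>2 + (norm (g \<omega>))\<^sup>2)"
    using f g by (simp add: square_integrable_def)
  show "(\<lambda>\<omega>. f \<omega> \<bullet> g \<omega>) \<in> borel_measurable M"
    using f g by (intro borel_measurable_inner square_integrable_measurable)
  show "AE \<omega> in M. norm (f \<omega> \<bullet> g \<omega>) \<le> norm ((norm (f \<omega>))\<^sup>2 + (norm (g \<omega>))\<^sup>2)"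
  proof (rule AE_I2)
    fix \<omega>
    have "\<bar>f \<omega> \<bullet> g \<omega>\<bar> \<le> norm (f \<omega>) * norm (g \<omega>)" by (rule Cauchy_Schwarz_ineq2)
    also have "\<dots> \<le> (norm (f \<omega>))\<^sup>2 + (norm (g \<omega>))\<^sup>2"
    proof -
      have "0 \<le> norm (f \<omega>) * norm (g \<omega>)" by simp
      then show ?thesis using sum_squares_bound[of "norm (f \<omega>)" "norm (g \<omega>)"] by linarith
    qed
    finally show "norm (f \<omega> \<bullet> g \<omega>) \<le> norm ((norm (f \<omega>))\<^sup>2 + (norm (g \<omega>))\<^sup>2)" by simp
  qed
qed

text \<open>The second part is Jensen's inequality in the form of nonnegative variance.\<close>

lemma square_integrable_integrable_norm:
  assumes M: "prob_space M" and f: "square_integrable M f"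
  shows "integrable M (\<lambda>\<omega>. norm (f \<omega>))"
    and "(\<integral>\<omega>. norm (f \<omega>) \<partial>M) \<le> sqrt (\<integral>\<omega>. (norm (f \<omega>))\<^sup>2 \<partial>M)"
proof -
  interpret prob_space M by (rule M)
  have "square_integrable M (\<lambda>\<omega>. norm (f \<omega>))"
    using square_integrable_measurable[OF f] by (intro square_integrable_bound[OF f, of _ 1]) auto
  from square_integrable_inner[OF this square_integrable_const[OF finite_measure_axioms, of 1]]
  show int: "integrable M (\<lambda>\<omega>. norm (f \<omega>))" by simp
  have "(expectation (\<lambda>\<omega>. norm (f \<omega>)))\<^sup>2 \<le> expectation (\<lambda>\<omega>. (norm (f \<omega>))\<^sup>2)"
  proof -
    have sq: "integrable M (\<lambda>\<omega>. (norm (f \<omega>))\<^sup>2)" using f by (simp add: square_integrable_def)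
    have "0 \<le> variance (\<lambda>\<omega>. norm (f \<omega>))" by (rule variance_positive)
    then show ?thesis unfolding variance_eq[OF int sq] by simp
  qed
  then show "(\<integral>\<omega>. norm (f \<omega>) \<partial>M) \<le> sqrt (\<integral>\<omega>. (norm (f \<omega>))\<^sup>2 \<partial>M)"
    by (intro real_le_rsqrt)
qed

lemma linear_entry: "linear (\<lambda>X :: real ^ 'd ^ 'n. X $ i $ c)"
  by (simp add: linear_iff)

lemma entry_measurable:
  fixes f :: "'w \<Rightarrow> real ^ 'd ^ 'n"
  assumes "f \<in> borel_measurable G"
  shows "(\<lambda>\<omega>. f \<omega> $ i $ c) \<in> borel_measurable G"
proof -
  have "continuous_on UNIV (\<lambda>X :: real ^ 'd ^ 'n. X $ i $ c)"
    by (rule linear_continuous_on[OF linear_conv_bounded_linear[THEN iffD1, OF linear_entry]])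
  then show ?thesis using assms by (rule borel_measurable_continuous_on)
qed

text \<open>Conditioning on \<open>G\<close>, coordinate by coordinate, since \<open>U\<close> is known given \<open>G\<close>.\<close>

lemma integral_inner_noise:
  fixes U \<xi> :: "'w \<Rightarrow> real ^ 'd ^ 'n"
  assumes M: "prob_space M" and sub: "subalgebra M G"
    and U: "square_integrable M U" "U \<in> borel_measurable G"
    and \<xi>: "square_integrable M \<xi>" "\<And>i. cond_mean_zero M G (\<lambda>\<omega>. \<xi> \<omega> $ i)"
  shows "(\<integral>\<omega>. U \<omega> \<bullet> \<xi> \<omega> \<partial>M) = 0"
proof -
  interpret prob_space M by (rule M)
  interpret finite_measure_subalgebra M G by standard (rule sub)
  have int: "integrable M (\<lambda>\<omega>. U \<omega> $ i $ c * \<xi> \<omega> $ i $ c)" for i c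
    using square_integrable_inner[OF square_integrable_linear[OF U(1) linear_entry]
        square_integrable_linear[OF \<xi>(1) linear_entry], of i c i c] by simp
  have zero: "(\<integral>\<omega>. U \<omega> $ i $ c * \<xi> \<omega> $ i $ c \<partial>M) = 0" for i c
  proof -
    have "(\<integral>\<omega>. U \<omega> $ i $ c * \<xi> \<omega> $ i $ c \<partial>M)
        = (\<integral>\<omega>. U \<omega> $ i $ c * real_cond_exp M G (\<lambda>\<omega>. \<xi> \<omega> $ i $ c) \<omega> \<partial>M)"
      by (rule real_cond_exp_intg(2)[symmetric, OF int entry_measurable[OF U(2)]
          entry_measurable[OF square_integrable_measurable[OF \<xi>(1)]]])
    also have "\<dots> = (\<integral>\<omega>. 0 \<partial>M)"
    proof (rule integral_cong_AE)
      have "AE \<omega> in M. real_cond_exp M G (\<lambda>\<omega>. \<xi> \<omega> $ i $ c) \<omega> = 0"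
        using \<xi>(2)[of i] by (simp add: cond_mean_zero_def)
      then show "AE \<omega> in M. U \<omega> $ i $ c * real_cond_exp M G (\<lambda>\<omega>. \<xi> \<omega> $ i $ c) \<omega> = 0" by auto
      show "(\<lambda>\<omega>. U \<omega> $ i $ c * real_cond_exp M G (\<lambda>\<omega>. \<xi> \<omega> $ i $ c) \<omega>) \<in> borel_measurable M"
        using entry_measurable[OF square_integrable_measurable[OF U(1)]]
        by (intro borel_measurable_times borel_measurable_cond_exp2)
    qed simp
    finally show ?thesis by simp
  qed
  have "(\<integral>\<omega>. U \<omega> \<bullet> \<xi> \<omega> \<partial>M) = (\<integral>\<omega>. (\<Sum>i\<in>UNIV. \<Sum>c\<in>UNIV. U \<omega> $ i $ c * \<xi> \<omega> $ i $ c) \<partial>M)"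
    by (simp add: inner_vec_def)
  also have "\<dots> = (\<Sum>i\<in>UNIV. \<Sum>c\<in>UNIV. (\<integral>\<omega>. U \<omega> $ i $ c * \<xi> \<omega> $ i $ c \<partial>M))"
    using int by (simp add: Bochner_Integration.integral_sum Bochner_Integration.integrable_sum)
  finally show ?thesis by (simp add: zero)
qed

text \<open>The nonnegative conditional expectation has the same integral as its argument, even when that is
  infinite; this is how integrability is obtained from the bound rather than presupposed.\<close>

lemma cond_second_moment_le_integral:
  fixes \<xi> :: "'w \<Rightarrow> real ^ 'd"
  assumes M: "prob_space M" and sub: "subalgebra M G"
    and \<xi>: "\<xi> \<in> borel_measurable M" "cond_second_moment_le M G \<xi> s" and s: "0 \<le> s"
  shows "integrable M (\<lambda>\<omega>. (norm (\<xi> \<omega>))\<^sup>2)" "(\<integral>\<omega>. (norm (\<xi> \<omega>))\<^sup>2 \<partial>M) \<le> s"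
proof -
  interpret prob_space M by (rule M)
  interpret finite_measure_subalgebra M G by standard (rule sub)
  have m: "(\<lambda>\<omega>. (norm (\<xi> \<omega>))\<^sup>2) \<in> borel_measurable M" using \<xi>(1) by measurable
  have "(\<integral>\<^sup>+\<omega>. ennreal ((norm (\<xi> \<omega>))\<^sup>2) \<partial>M)
      = (\<integral>\<^sup>+\<omega>. nn_cond_exp M G (\<lambda>\<omega>. ennreal ((norm (\<xi> \<omega>))\<^sup>2)) \<omega> \<partial>M)"
    using nn_cond_exp_intg[of "\<lambda>_. 1" "\<lambda>\<omega>. ennreal ((norm (\<xi> \<omega>))\<^sup>2)"] m by simp
  also have "\<dots> \<le> (\<integral>\<^sup>+\<omega>. ennreal s \<partial>M)"
    using \<xi>(2) by (intro nn_integral_mono_AE) (simp add: cond_second_moment_le_def)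
  finally have le: "(\<integral>\<^sup>+\<omega>. ennreal ((norm (\<xi> \<omega>))\<^sup>2) \<partial>M) \<le> ennreal s"
    by (simp add: emeasure_space_1)
  show int: "integrable M (\<lambda>\<omega>. (norm (\<xi> \<omega>))\<^sup>2)"
    using m le by (intro integrableI_nonneg) (auto simp: le_less_trans)
  have "ennreal (\<integral>\<omega>. (norm (\<xi> \<omega>))\<^sup>2 \<partial>M) \<le> ennreal s"
    using le nn_integral_eq_integral[OF int] by simp
  then show "(\<integral>\<omega>. (norm (\<xi> \<omega>))\<^sup>2 \<partial>M) \<le> s" using s by simp
qed

lemma stacked_second_moment_le:
  fixes \<xi> :: "'w \<Rightarrow> real ^ 'd ^ 'n"
  assumes M: "prob_space M" and sub: "subalgebra M G"
    and \<xi>: "\<xi> \<in> borel_measurable M" "\<And>i. cond_second_moment_le M G (\<lambda>\<omega>. \<xi> \<omega> $ i) s" and s: "0 \<le> s"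
  shows "square_integrable M \<xi>" "(\<integral>\<omega>. (norm (\<xi> \<omega>))\<^sup>2 \<partial>M) \<le> real CARD('n) * s"
proof -
  have m: "(\<lambda>\<omega>. \<xi> \<omega> $ i) \<in> borel_measurable M" for i
    by (rule borel_measurable_continuous_on[OF _ \<xi>(1)])
      (intro linear_continuous_on bounded_linear_vec_nth)
  note moment = cond_second_moment_le_integral[OF M sub m \<xi>(2) s]
  have sq: "(norm (\<xi> \<omega>))\<^sup>2 = (\<Sum>i\<in>UNIV. (norm (\<xi> \<omega> $ i))\<^sup>2)" for \<omega>
    by (rule norm_vec_sq)
  show "square_integrable M \<xi>"
    using \<xi>(1) moment(1) by (simp add: square_integrable_def sq)
  have "(\<integral>\<omega>. (norm (\<xi> \<omega>))\<^sup>2 \<partial>M) = (\<Sum>i\<in>UNIV. (\<integral>\<omega>. (norm (\<xi> \<omega> $ i))\<^sup>2 \<partial>M))"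
    unfolding sq using moment(1) by (intro Bochner_Integration.integral_sum)
  also have "\<dots> \<le> (\<Sum>i\<in>(UNIV :: 'n set). s)" by (intro sum_mono moment(2))
  finally show "(\<integral>\<omega>. (norm (\<xi> \<omega>))\<^sup>2 \<partial>M) \<le> real CARD('n) * s" by simp
qed

section \<open>A Lyapunov function for the primal-dual iteration\<close>

text \<open>The mathematical setting of one step, with everything about graphs and coordinates abstracted away:
  \<open>T\<close> plays the Laplacian with norm bound \<open>r\<close> and spectral gap \<open>m\<close>, \<open>\<Phi>\<close> the stacked gradient with Lipschitz
  constant \<open>K\<close>, and \<open>S\<close> the set of stacked minimizers, on which \<open>\<Phi>\<close> has the constant value \<open>\<Phi>0\<close>. The
  number \<open>e\<close> weighs the distance terms of the Lyapunov function; it must be large enough for their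
  dissipation to absorb what the cross term costs.\<close>

locale primal_dual =
  fixes T \<Phi> :: "'a::euclidean_space \<Rightarrow> 'a" and S :: "'a set" and \<Phi>0 :: 'a
    and \<alpha> \<beta> r m K \<nu> e :: real
  assumes linear_T: "linear T" and self_adjoint: "\<And>x y. x \<bullet> T y = T x \<bullet> y"
    and form_nonneg: "\<And>y. 0 \<le> y \<bullet> T y"
    and norm_T_le: "\<And>y. norm (T y) \<le> r * norm y"
    and form_le: "\<And>y. y \<bullet> T y \<le> (norm (T y))\<^sup>2 / m"
    and S: "closed S" "convex S" "S \<noteq> {}"
    and T_S: "\<And>z. z \<in> S \<Longrightarrow> T z = 0" and \<Phi>_S: "\<And>z. z \<in> S \<Longrightarrow> \<Phi> z = \<Phi>0"
    and lipschitz: "\<And>x y. norm (\<Phi> x - \<Phi> y) \<le> K * norm (x - y)"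
    and secant: "\<And>x. \<nu> * (norm (x - closest_point S x))\<^sup>2
      \<le> \<alpha> * (x \<bullet> T x) + (x - closest_point S x) \<bullet> (\<Phi> x - \<Phi>0)"
    and pos: "0 < \<alpha>" "0 < \<beta>" "0 < m" "0 \<le> K" "0 \<le> r"
    and weight: "1 / 2 \<le> e" "K\<^sup>2 / (2 * \<beta>) + \<beta> * r \<le> e * \<nu>"
begin

sublocale T: linear T by (rule linear_T)

definition dev :: "'a \<Rightarrow> 'a" where
  "dev x = x - closest_point S x"

text \<open>The second argument is a preimage of the dual error under \<open>T\<close>; thus \<open>w \<bullet> T w\<close> is the quadratic form of
  the pseudo-inverse of \<open>T\<close> at the dual error \<open>T w\<close>.\<close>

definition V :: "'a \<Rightarrow> 'a \<Rightarrow> real" where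
  "V x w = e * (norm (dev x))\<^sup>2 + e * (w \<bullet> T w) + T w \<bullet> x + \<alpha> / (2 * \<beta>) * (norm (T w))\<^sup>2"

definition drift :: "'a \<Rightarrow> 'a \<Rightarrow> 'a" where
  "drift x w = \<alpha> *\<^sub>R T x + \<beta> *\<^sub>R T w + (\<Phi> x - \<Phi>0)"

lemma closest_in: "closest_point S x \<in> S"
  using S closest_point_in_set by blast

lemma T_dev [simp]: "T (dev x) = T x"
  using T_S[OF closest_in] by (simp add: dev_def T.diff)

text \<open>The dual error is orthogonal to the kernel of \<open>T\<close>, so it does not see the projection onto \<open>S\<close>.\<close>

lemma T_inner_dev: "T w \<bullet> dev x = T w \<bullet> x"
  using T_dev[of x] self_adjoint[of w x] self_adjoint[of w "dev x"] by simp

lemma norm_\<Phi>_le: "norm (\<Phi> x - \<Phi>0) \<le> K * norm (dev x)"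
  using lipschitz[of x "closest_point S x"] \<Phi>_S[OF closest_in] by (simp add: dev_def)

lemma norm_T_dev_le: "norm (T x) \<le> r * norm (dev x)"
  using norm_T_le[of "dev x"] by simp

lemma abs_cross_le: "\<bar>T w \<bullet> x\<bar> \<le> (norm (T w))\<^sup>2 / 2 + (norm (dev x))\<^sup>2 / 2"
proof -
  have "\<bar>T w \<bullet> dev x\<bar> \<le> norm (T w) * norm (dev x)" by (rule Cauchy_Schwarz_ineq2)
  also have "\<dots> \<le> (norm (T w))\<^sup>2 / 2 + (norm (dev x))\<^sup>2 / 2"
    using sum_squares_bound[of "norm (T w)" "norm (dev x)"] by simp
  finally show ?thesis by (simp only: T_inner_dev)
qed

lemma V_lower: "(e - 1 / 2) * (norm (dev x))\<^sup>2 + (\<alpha> / (2 * \<beta>) - 1 / 2) * (norm (T w))\<^sup>2 \<le> V x w"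
proof -
  have "0 \<le> e * (w \<bullet> T w)" using form_nonneg weight(1) by (intro mult_nonneg_nonneg) auto
  then show ?thesis using abs_cross_le[of w x] by (simp add: V_def algebra_simps)
qed

lemma V_upper: "V x w \<le> (e + 1 / 2) * (norm (dev x))\<^sup>2 + (e / m + \<alpha> / (2 * \<beta>) + 1 / 2) * (norm (T w))\<^sup>2"
proof -
  have "e * (w \<bullet> T w) \<le> e * ((norm (T w))\<^sup>2 / m)" using form_le weight(1) by (intro mult_left_mono) auto
  then show ?thesis using abs_cross_le[of w x] by (simp add: V_def algebra_simps)
qed

text \<open>The squared distance at the new point is at most that to the old projection, so all of \<open>V\<close> is bounded
  by a quadratic function of the step that agrees with \<open>V\<close> to first order; its second-order part is
  then made diagonal by Young's inequality and \<open>form_le\<close>.\<close>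

lemma V_increment:
  "V (x + \<delta>) (w + \<omega>) \<le> V x w
    + (2 * e * (dev x \<bullet> \<delta>) + 2 * e * (T w \<bullet> \<omega>) + T w \<bullet> \<delta> + T \<omega> \<bullet> x + \<alpha> / \<beta> * (T w \<bullet> T \<omega>))
    + (e + 1 / 2) * (norm \<delta>)\<^sup>2 + (e / m + 1 / 2 + \<alpha> / (2 * \<beta>)) * (norm (T \<omega>))\<^sup>2"
proof -
  have "norm (dev (x + \<delta>)) \<le> norm (dev x + \<delta>)"
    using closest_point_le[OF S(1) closest_in[of x], of "x + \<delta>"]
    unfolding dev_def dist_norm by (simp only: diff_add_eq)
  then have "(norm (dev (x + \<delta>)))\<^sup>2 \<le> (norm (dev x + \<delta>))\<^sup>2" by (intro power_mono) auto
  also have "\<dots> = (norm (dev x))\<^sup>2 + 2 * (dev x \<bullet> \<delta>) + (norm \<delta>)\<^sup>2"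
    by (rule norm_add_squared)
  finally have 1: "e * (norm (dev (x + \<delta>)))\<^sup>2 \<le> e * ((norm (dev x))\<^sup>2 + 2 * (dev x \<bullet> \<delta>) + (norm \<delta>)\<^sup>2)"
    using weight(1) by (intro mult_left_mono) auto
  have 2: "(w + \<omega>) \<bullet> T (w + \<omega>) = w \<bullet> T w + 2 * (T w \<bullet> \<omega>) + \<omega> \<bullet> T \<omega>"
    using self_adjoint[of w \<omega>] inner_commute[of \<omega> "T w"]
    by (simp add: T.add inner_left_distrib inner_right_distrib)
  have 3: "e * (\<omega> \<bullet> T \<omega>) \<le> e * ((norm (T \<omega>))\<^sup>2 / m)"
    using form_le weight(1) by (intro mult_left_mono) auto
  have "T \<omega> \<bullet> \<delta> \<le> norm (T \<omega>) * norm \<delta>" by (rule norm_cauchy_schwarz)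
  then have 4: "T \<omega> \<bullet> \<delta> \<le> (norm (T \<omega>))\<^sup>2 / 2 + (norm \<delta>)\<^sup>2 / 2"
    using sum_squares_bound[of "norm (T \<omega>)" "norm \<delta>"] by simp
  have 5: "(norm (T (w + \<omega>)))\<^sup>2 = (norm (T w))\<^sup>2 + 2 * (T w \<bullet> T \<omega>) + (norm (T \<omega>))\<^sup>2"
    by (simp only: T.add norm_add_squared)
  have 6: "T (w + \<omega>) \<bullet> (x + \<delta>) = T w \<bullet> x + T w \<bullet> \<delta> + T \<omega> \<bullet> x + T \<omega> \<bullet> \<delta>"
    by (simp add: T.add inner_left_distrib inner_right_distrib)
  have arith: "e * a' + e * (f + 2 * g + f') + (c + c1 + c2 + c3) + k * (t + 2 * t1 + t')
      \<le> e * a + e * f + c + k * t + (2 * e * a1 + 2 * e * g + c1 + c2 + 2 * k * t1)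
        + (e + 1 / 2) * d + (e / m + 1 / 2 + k) * t'"
    if "e * a' \<le> e * (a + 2 * a1 + d)" "e * f' \<le> e * (t' / m)" "c3 \<le> t' / 2 + d / 2"
    for a a' a1 c c1 c2 c3 d f f' g k t t' t1 :: real
    using that by (simp add: ring_distribs)
  have k: "\<alpha> / \<beta> = 2 * (\<alpha> / (2 * \<beta>))" by simp
  show ?thesis
    unfolding V_def 2 5 6 k by (rule arith[OF 1 3 4])
qed

text \<open>The left-hand side is the first-order part of \<open>V_increment\<close> along the noiseless step, divided by the
  step size. The terms \<open>T w \<bullet> x\<close> cancel between the two distance terms, and \<open>T w \<bullet> T x\<close> cancels between
  the cross term and the last term of \<open>V\<close>. The cross term contributes \<open>- \<beta> * (norm (T w))\<^sup>2\<close>; half of it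
  pays for the gradient difference by Young's inequality.\<close>

lemma drift_dissipates:
  "- 2 * e * (dev x \<bullet> drift x w) + 2 * e * \<beta> * (T w \<bullet> x) - T w \<bullet> drift x w
      + \<beta> * (T x \<bullet> x) + \<alpha> * (T w \<bullet> T x)
    \<le> - e * \<nu> * (norm (dev x))\<^sup>2 - \<beta> / 2 * (norm (T w))\<^sup>2"
proof -
  let ?g = "\<Phi> x - \<Phi>0"
  have a: "dev x \<bullet> T x = x \<bullet> T x" using T_inner_dev[of x x] by (simp only: inner_commute)
  have b: "dev x \<bullet> T w = T w \<bullet> x" using T_inner_dev[of w x] by (simp only: inner_commute)
  have d1: "dev x \<bullet> drift x w = \<alpha> * (x \<bullet> T x) + \<beta> * (T w \<bullet> x) + dev x \<bullet> ?g"
    unfolding drift_def by (simp only: inner_right_distrib inner_scaleR_right a b)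
  have d2: "T w \<bullet> drift x w = \<alpha> * (T w \<bullet> T x) + \<beta> * (norm (T w))\<^sup>2 + T w \<bullet> ?g"
    unfolding drift_def by (simp only: inner_right_distrib inner_scaleR_right power2_norm_eq_inner)
  have s: "2 * e * (\<nu> * (norm (dev x))\<^sup>2) \<le> 2 * e * (\<alpha> * (x \<bullet> T x) + dev x \<bullet> ?g)"
    using secant[of x] weight(1) unfolding dev_def by (intro mult_left_mono) auto
  have "T x \<bullet> x \<le> r * (norm (dev x))\<^sup>2"
  proof -
    have "T x \<bullet> x = T x \<bullet> dev x" by (rule T_inner_dev[symmetric])
    also have "\<dots> \<le> norm (T x) * norm (dev x)" by (rule norm_cauchy_schwarz)
    also have "\<dots> \<le> r * norm (dev x) * norm (dev x)"
      by (intro mult_right_mono norm_T_dev_le) simp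
    finally show ?thesis by (simp only: power2_eq_square mult.assoc)
  qed
  then have t: "\<beta> * (T x \<bullet> x) \<le> \<beta> * (r * (norm (dev x))\<^sup>2)"
    using pos by (intro mult_left_mono) auto
  have g: "- (T w \<bullet> ?g) \<le> \<beta> / 2 * (norm (T w))\<^sup>2 + K\<^sup>2 / (2 * \<beta>) * (norm (dev x))\<^sup>2"
  proof -
    have "- (T w \<bullet> ?g) \<le> norm (T w) * norm ?g"
      using Cauchy_Schwarz_ineq2[of "T w" ?g] by simp
    also have "\<dots> \<le> norm (T w) * (K * norm (dev x))"
      by (intro mult_left_mono norm_\<Phi>_le) simp
    also have "\<dots> \<le> \<beta> / 2 * (norm (T w))\<^sup>2 + K\<^sup>2 / (2 * \<beta>) * (norm (dev x))\<^sup>2"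
    proof -
      have "0 \<le> (\<beta> * norm (T w) - K * norm (dev x))\<^sup>2 / (2 * \<beta>)"
        using pos by simp
      also have "\<dots> = \<beta> / 2 * (norm (T w))\<^sup>2 + K\<^sup>2 / (2 * \<beta>) * (norm (dev x))\<^sup>2
          - norm (T w) * (K * norm (dev x))"
        using pos by (simp add: power2_eq_square field_simps)
      finally show ?thesis by simp
    qed
    finally show ?thesis .
  qed
  have w: "(K\<^sup>2 / (2 * \<beta>) + \<beta> * r) * (norm (dev x))\<^sup>2 \<le> e * \<nu> * (norm (dev x))\<^sup>2"
    by (intro mult_right_mono weight(2)) simp
  show ?thesis
    unfolding d1 d2 using s t g w by (simp add: algebra_simps)
qed

lemma norm_drift_le:
  "(norm (drift x w))\<^sup>2 \<le> 3 * (\<alpha>\<^sup>2 * r\<^sup>2 + K\<^sup>2) * (norm (dev x))\<^sup>2 + 3 * \<beta>\<^sup>2 * (norm (T w))\<^sup>2"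
proof -
  let ?a = "\<alpha> * norm (T x)" and ?b = "\<beta> * norm (T w)" and ?c = "norm (\<Phi> x - \<Phi>0)"
  have "norm (drift x w) \<le> ?a + ?b + ?c"
    unfolding drift_def using pos by (intro norm_triangle_le add_mono) auto
  then have "(norm (drift x w))\<^sup>2 \<le> (?a + ?b + ?c)\<^sup>2" by (intro power_mono) auto
  also have "\<dots> \<le> 3 * (?a\<^sup>2 + ?b\<^sup>2 + ?c\<^sup>2)"
    using sum_squares_bound[of ?a ?b] sum_squares_bound[of ?b ?c] sum_squares_bound[of ?a ?c]
    by (simp add: power2_eq_square algebra_simps)
  also have "\<dots> \<le> 3 * ((\<alpha> * (r * norm (dev x)))\<^sup>2 + ?b\<^sup>2 + (K * norm (dev x))\<^sup>2)"
    using pos norm_T_dev_le norm_\<Phi>_le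
    by (intro mult_left_mono add_mono power_mono mult_nonneg_nonneg) auto
  finally show ?thesis by (simp add: power_mult_distrib algebra_simps)
qed

text \<open>The second-order coefficients of \<open>V_increment\<close> for the primal and for the dual step.\<close>

definition cx :: real where "cx = e + 1 / 2"
definition cv :: real where "cv = e / m + 1 / 2 + \<alpha> / (2 * \<beta>)"

text \<open>The vectors that multiply the gradient noise and the quantization noise in the part of the new
  value of \<open>V\<close> that is linear in the noise. They are functions of the current state alone, which is
  what makes this part vanish in expectation.\<close>

definition grad_weight :: "real \<Rightarrow> 'a \<Rightarrow> 'a \<Rightarrow> 'a" where
  "grad_weight h x w = (2 * h\<^sup>2 * cx) *\<^sub>R drift x w - (2 * h * e) *\<^sub>R dev x - h *\<^sub>R T w"

definition quant_weight :: "real \<Rightarrow> 'a \<Rightarrow> 'a \<Rightarrow> 'a" where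
  "quant_weight h x w = \<alpha> *\<^sub>R T (grad_weight h x w) + (2 * e * h * \<beta>) *\<^sub>R T w + (h * \<beta>) *\<^sub>R T x
    + (h * \<alpha>) *\<^sub>R T (T w) + (2 * h\<^sup>2 * cv * \<beta>\<^sup>2) *\<^sub>R T (T x)"

lemma V_step:
  assumes h: "0 \<le> h"
  shows "V (x - h *\<^sub>R (drift x w + (\<alpha> *\<^sub>R T \<xi> + \<zeta>))) (w + (h * \<beta>) *\<^sub>R (x + \<xi>)) \<le> V x w
    - h * (e * \<nu> * (norm (dev x))\<^sup>2 + \<beta> / 2 * (norm (T w))\<^sup>2)
    + h\<^sup>2 * ((cx * (3 * (\<alpha>\<^sup>2 * r\<^sup>2 + K\<^sup>2)) + cv * \<beta>\<^sup>2 * r\<^sup>2) * (norm (dev x))\<^sup>2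
        + cx * (3 * \<beta>\<^sup>2) * (norm (T w))\<^sup>2)
    + h\<^sup>2 * ((cx * (2 * \<alpha>\<^sup>2) + cv * \<beta>\<^sup>2) * r\<^sup>2 * (norm \<xi>)\<^sup>2 + 2 * cx * (norm \<zeta>)\<^sup>2)
    + (grad_weight h x w \<bullet> \<zeta> + quant_weight h x w \<bullet> \<xi>)"
proof -
  define D where "D = drift x w"
  define N where "N = \<alpha> *\<^sub>R T \<xi> + \<zeta>"
  have cx0: "0 \<le> cx" and cv0: "0 \<le> cv"
    using weight(1) pos by (auto simp: cx_def cv_def)
  define \<delta> where "\<delta> = - h *\<^sub>R (D + N)"
  define \<omega> where "\<omega> = (h * \<beta>) *\<^sub>R (x + \<xi>)"
  have T\<omega>: "T \<omega> = (h * \<beta>) *\<^sub>R (T x + T \<xi>)" by (simp add: \<omega>_def T.add T.scaleR)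
  have n\<delta>: "(norm \<delta>)\<^sup>2 = h\<^sup>2 * ((norm D)\<^sup>2 + 2 * (D \<bullet> N) + (norm N)\<^sup>2)"
    unfolding \<delta>_def norm_scaleR power_mult_distrib norm_add_squared by simp
  have n\<omega>: "(norm (T \<omega>))\<^sup>2 = h\<^sup>2 * \<beta>\<^sup>2 * ((norm (T x))\<^sup>2 + 2 * (T x \<bullet> T \<xi>) + (norm (T \<xi>))\<^sup>2)"
    unfolding T\<omega> norm_scaleR power_mult_distrib norm_add_squared by (simp add: power_mult_distrib)
  have nN: "(norm N)\<^sup>2 \<le> 2 * \<alpha>\<^sup>2 * r\<^sup>2 * (norm \<xi>)\<^sup>2 + 2 * (norm \<zeta>)\<^sup>2"
  proof -
    have "norm N \<le> \<alpha> * (r * norm \<xi>) + norm \<zeta>"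
      unfolding N_def using norm_T_le[of \<xi>] pos by (intro norm_triangle_le add_mono) auto
    then have "(norm N)\<^sup>2 \<le> (\<alpha> * (r * norm \<xi>) + norm \<zeta>)\<^sup>2" by (intro power_mono) auto
    also have "\<dots> \<le> 2 * (\<alpha> * (r * norm \<xi>))\<^sup>2 + 2 * (norm \<zeta>)\<^sup>2"
      using sum_squares_bound[of "\<alpha> * (r * norm \<xi>)" "norm \<zeta>"] by (simp add: power2_sum)
    finally show ?thesis by (simp add: power_mult_distrib)
  qed
  have nTx: "(norm (T x))\<^sup>2 \<le> r\<^sup>2 * (norm (dev x))\<^sup>2"
    using power_mono[OF norm_T_dev_le[of x] norm_ge_zero, of 2] by (simp add: power_mult_distrib)
  have nT\<xi>: "(norm (T \<xi>))\<^sup>2 \<le> r\<^sup>2 * (norm \<xi>)\<^sup>2"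
    using power_mono[OF norm_T_le[of \<xi>] norm_ge_zero, of 2] by (simp add: power_mult_distrib)
  have nD: "(norm D)\<^sup>2 \<le> 3 * (\<alpha>\<^sup>2 * r\<^sup>2 + K\<^sup>2) * (norm (dev x))\<^sup>2 + 3 * \<beta>\<^sup>2 * (norm (T w))\<^sup>2"
    unfolding D_def by (rule norm_drift_le)
  have quad_x: "cx * (norm \<delta>)\<^sup>2 \<le> h\<^sup>2 * (cx * (3 * (\<alpha>\<^sup>2 * r\<^sup>2 + K\<^sup>2) * (norm (dev x))\<^sup>2 + 3 * \<beta>\<^sup>2 * (norm (T w))\<^sup>2)
      + 2 * cx * (D \<bullet> N) + cx * (2 * \<alpha>\<^sup>2 * r\<^sup>2 * (norm \<xi>)\<^sup>2 + 2 * (norm \<zeta>)\<^sup>2))"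
  proof -
    have "cx * (norm \<delta>)\<^sup>2 = h\<^sup>2 * (cx * (norm D)\<^sup>2 + 2 * cx * (D \<bullet> N) + cx * (norm N)\<^sup>2)"
      unfolding n\<delta> by (simp add: algebra_simps)
    also have "\<dots> \<le> h\<^sup>2 * (cx * (3 * (\<alpha>\<^sup>2 * r\<^sup>2 + K\<^sup>2) * (norm (dev x))\<^sup>2 + 3 * \<beta>\<^sup>2 * (norm (T w))\<^sup>2)
      + 2 * cx * (D \<bullet> N) + cx * (2 * \<alpha>\<^sup>2 * r\<^sup>2 * (norm \<xi>)\<^sup>2 + 2 * (norm \<zeta>)\<^sup>2))"
      by (rule mult_left_mono[OF add_mono[OF add_mono[OF mult_left_mono[OF nD cx0] order_refl]
          mult_left_mono[OF nN cx0]]]) simp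
    finally show ?thesis .
  qed
  have quad_w: "cv * (norm (T \<omega>))\<^sup>2 \<le> h\<^sup>2 * (cv * \<beta>\<^sup>2 * (r\<^sup>2 * (norm (dev x))\<^sup>2)
      + 2 * cv * \<beta>\<^sup>2 * (T x \<bullet> T \<xi>) + cv * \<beta>\<^sup>2 * (r\<^sup>2 * (norm \<xi>)\<^sup>2))"
  proof -
    have "cv * (norm (T \<omega>))\<^sup>2 = h\<^sup>2 * (cv * \<beta>\<^sup>2 * (norm (T x))\<^sup>2
        + 2 * cv * \<beta>\<^sup>2 * (T x \<bullet> T \<xi>) + cv * \<beta>\<^sup>2 * (norm (T \<xi>))\<^sup>2)"
      unfolding n\<omega> by (simp add: algebra_simps)
    also have "\<dots> \<le> h\<^sup>2 * (cv * \<beta>\<^sup>2 * (r\<^sup>2 * (norm (dev x))\<^sup>2)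
      + 2 * cv * \<beta>\<^sup>2 * (T x \<bullet> T \<xi>) + cv * \<beta>\<^sup>2 * (r\<^sup>2 * (norm \<xi>)\<^sup>2))"
      using cv0 by (intro mult_left_mono[OF add_mono[OF add_mono[OF mult_left_mono[OF nTx] order_refl]
          mult_left_mono[OF nT\<xi>]]]) simp_all
    finally show ?thesis .
  qed
  have lin: "2 * e * (dev x \<bullet> \<delta>) + 2 * e * (T w \<bullet> \<omega>) + T w \<bullet> \<delta> + T \<omega> \<bullet> x + \<alpha> / \<beta> * (T w \<bullet> T \<omega>)
      = h * (- 2 * e * (dev x \<bullet> D) + 2 * e * \<beta> * (T w \<bullet> x) - T w \<bullet> D + \<beta> * (T x \<bullet> x) + \<alpha> * (T w \<bullet> T x))
      + h * (- 2 * e * (dev x \<bullet> N) + 2 * e * \<beta> * (T w \<bullet> \<xi>) - T w \<bullet> N + \<beta> * (T \<xi> \<bullet> x) + \<alpha> * (T w \<bullet> T \<xi>))"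
  proof -
    have arith: "2 * e * (- h * (a + b)) + 2 * e * (h * \<beta> * (c + c')) + - h * (d + d')
        + h * \<beta> * (f + f') + h * \<alpha> * (g + g')
      = h * (- 2 * e * a + 2 * e * \<beta> * c - d + \<beta> * f + \<alpha> * g)
        + h * (- 2 * e * b + 2 * e * \<beta> * c' - d' + \<beta> * f' + \<alpha> * g')"
      for a b c c' d d' f f' g g' :: real
      by (simp add: algebra_simps)
    have "dev x \<bullet> \<delta> = - h * (dev x \<bullet> D + dev x \<bullet> N)"
      unfolding \<delta>_def by (simp only: inner_scaleR_right inner_right_distrib)
    moreover have "T w \<bullet> \<delta> = - h * (T w \<bullet> D + T w \<bullet> N)"
      unfolding \<delta>_def by (simp only: inner_scaleR_right inner_right_distrib)
    moreover have "T w \<bullet> \<omega> = h * \<beta> * (T w \<bullet> x + T w \<bullet> \<xi>)"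
      unfolding \<omega>_def by (simp only: inner_scaleR_right inner_right_distrib)
    moreover have "T \<omega> \<bullet> x = h * \<beta> * (T x \<bullet> x + T \<xi> \<bullet> x)"
      unfolding T\<omega> by (simp only: inner_scaleR_left inner_left_distrib)
    moreover have "\<alpha> / \<beta> * (T w \<bullet> T \<omega>) = h * \<alpha> * (T w \<bullet> T x + T w \<bullet> T \<xi>)"
      unfolding T\<omega> using pos by (simp add: inner_right_distrib)
    ultimately show ?thesis by (simp only:) (rule arith)
  qed
  have noise: "grad_weight h x w \<bullet> \<zeta> + quant_weight h x w \<bullet> \<xi>
      = h * (- 2 * e * (dev x \<bullet> N) + 2 * e * \<beta> * (T w \<bullet> \<xi>) - T w \<bullet> N + \<beta> * (T \<xi> \<bullet> x) + \<alpha> * (T w \<bullet> T \<xi>))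
      + h\<^sup>2 * (2 * cx * (D \<bullet> N)) + h\<^sup>2 * (2 * cv * \<beta>\<^sup>2 * (T x \<bullet> T \<xi>))"
  proof -
    let ?G = "grad_weight h x w"
    have adj: "T u \<bullet> \<xi> = u \<bullet> T \<xi>" for u by (rule self_adjoint[symmetric])
    have "?G \<bullet> \<zeta> + quant_weight h x w \<bullet> \<xi> = ?G \<bullet> N + 2 * e * h * \<beta> * (T w \<bullet> \<xi>) + h * \<beta> * (x \<bullet> T \<xi>)
        + h * \<alpha> * (T w \<bullet> T \<xi>) + 2 * h\<^sup>2 * cv * \<beta>\<^sup>2 * (T x \<bullet> T \<xi>)"
      unfolding quant_weight_def N_def
      by (simp only: inner_left_distrib inner_right_distrib inner_scaleR_left inner_scaleR_right
          adj[of ?G] adj[of x] adj[of "T w"] adj[of "T x"])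
    moreover have "?G \<bullet> N = 2 * h\<^sup>2 * cx * (D \<bullet> N) - 2 * h * e * (dev x \<bullet> N) - h * (T w \<bullet> N)"
      unfolding grad_weight_def D_def by (simp only: inner_diff_left inner_scaleR_left)
    ultimately show ?thesis
      by (simp only: inner_commute[of x "T \<xi>"]) (simp add: algebra_simps)
  qed
  have diss: "h * (- 2 * e * (dev x \<bullet> D) + 2 * e * \<beta> * (T w \<bullet> x) - T w \<bullet> D + \<beta> * (T x \<bullet> x) + \<alpha> * (T w \<bullet> T x))
      \<le> h * (- e * \<nu> * (norm (dev x))\<^sup>2 - \<beta> / 2 * (norm (T w))\<^sup>2)"
    unfolding D_def by (intro mult_left_mono drift_dissipates h)
  have eq: "x - h *\<^sub>R (drift x w + (\<alpha> *\<^sub>R T \<xi> + \<zeta>)) = x + \<delta>"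
    by (simp add: \<delta>_def D_def N_def)
  have "V (x + \<delta>) (w + \<omega>) \<le> V x w
    + (2 * e * (dev x \<bullet> \<delta>) + 2 * e * (T w \<bullet> \<omega>) + T w \<bullet> \<delta> + T \<omega> \<bullet> x + \<alpha> / \<beta> * (T w \<bullet> T \<omega>))
    + cx * (norm \<delta>)\<^sup>2 + cv * (norm (T \<omega>))\<^sup>2"
    unfolding cx_def cv_def by (rule V_increment)
  also have "\<dots> \<le> V x w
    + (h * (- e * \<nu> * (norm (dev x))\<^sup>2 - \<beta> / 2 * (norm (T w))\<^sup>2)
      + h * (- 2 * e * (dev x \<bullet> N) + 2 * e * \<beta> * (T w \<bullet> \<xi>) - T w \<bullet> N + \<beta> * (T \<xi> \<bullet> x) + \<alpha> * (T w \<bullet> T \<xi>)))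
    + h\<^sup>2 * (cx * (3 * (\<alpha>\<^sup>2 * r\<^sup>2 + K\<^sup>2) * (norm (dev x))\<^sup>2 + 3 * \<beta>\<^sup>2 * (norm (T w))\<^sup>2)
      + 2 * cx * (D \<bullet> N) + cx * (2 * \<alpha>\<^sup>2 * r\<^sup>2 * (norm \<xi>)\<^sup>2 + 2 * (norm \<zeta>)\<^sup>2))
    + h\<^sup>2 * (cv * \<beta>\<^sup>2 * (r\<^sup>2 * (norm (dev x))\<^sup>2)
      + 2 * cv * \<beta>\<^sup>2 * (T x \<bullet> T \<xi>) + cv * \<beta>\<^sup>2 * (r\<^sup>2 * (norm \<xi>)\<^sup>2))"
    unfolding lin by (intro add_mono order_refl diss quad_x quad_w)
  also have "\<dots> = V x w
    - h * (e * \<nu> * (norm (dev x))\<^sup>2 + \<beta> / 2 * (norm (T w))\<^sup>2)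
    + h\<^sup>2 * ((cx * (3 * (\<alpha>\<^sup>2 * r\<^sup>2 + K\<^sup>2)) + cv * \<beta>\<^sup>2 * r\<^sup>2) * (norm (dev x))\<^sup>2
        + cx * (3 * \<beta>\<^sup>2) * (norm (T w))\<^sup>2)
    + h\<^sup>2 * ((cx * (2 * \<alpha>\<^sup>2) + cv * \<beta>\<^sup>2) * r\<^sup>2 * (norm \<xi>)\<^sup>2 + 2 * cx * (norm \<zeta>)\<^sup>2)
    + (grad_weight h x w \<bullet> \<zeta> + quant_weight h x w \<bullet> \<xi>)"
  proof -
    have arith: "a + (h * (- e * \<nu> * p - \<beta> / 2 * t) + b)
        + h\<^sup>2 * (cx * (3 * (\<alpha>\<^sup>2 * r\<^sup>2 + K\<^sup>2) * p + 3 * \<beta>\<^sup>2 * t) + c + cx * (2 * \<alpha>\<^sup>2 * r\<^sup>2 * q + 2 * z))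
        + h\<^sup>2 * (cv * \<beta>\<^sup>2 * (r\<^sup>2 * p) + d + cv * \<beta>\<^sup>2 * (r\<^sup>2 * q))
      = a - h * (e * \<nu> * p + \<beta> / 2 * t)
        + h\<^sup>2 * ((cx * (3 * (\<alpha>\<^sup>2 * r\<^sup>2 + K\<^sup>2)) + cv * \<beta>\<^sup>2 * r\<^sup>2) * p + cx * (3 * \<beta>\<^sup>2) * t)
        + h\<^sup>2 * ((cx * (2 * \<alpha>\<^sup>2) + cv * \<beta>\<^sup>2) * r\<^sup>2 * q + 2 * cx * z)
        + (b + h\<^sup>2 * c + h\<^sup>2 * d)" for a b c d p t q z :: real
      by (simp add: algebra_simps)
    show ?thesis unfolding noise by (rule arith)
  qed
  finally show ?thesis unfolding eq \<omega>_def .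
qed

end

section \<open>Contraction of the Lyapunov function\<close>

text \<open>The constants of the convergence theorem, reduced to the inequalities that the argument uses.\<close>

locale primal_dual_step = primal_dual +
  fixes h \<epsilon>2 \<epsilon>3 \<epsilon>4 \<epsilon>5 \<eta> :: real
  assumes h: "0 \<le> h"
    and \<epsilon>2: "0 \<le> \<epsilon>2" "\<epsilon>2 \<le> \<beta> / 2" "\<epsilon>2 \<le> e * \<nu>"
    and \<epsilon>3: "e + 1 / 2 \<le> \<epsilon>3" "e / m + \<alpha> / (2 * \<beta>) + 1 / 2 \<le> \<epsilon>3"
    and \<epsilon>4: "0 < \<epsilon>4" "\<epsilon>4 \<le> e - 1 / 2" "\<epsilon>4 \<le> \<alpha> / (2 * \<beta>) - 1 / 2"
    and \<epsilon>5: "\<beta>\<^sup>2 * r\<^sup>2 + 3 * \<alpha>\<^sup>2 * r\<^sup>2 + 3 * K\<^sup>2 \<le> \<epsilon>5" "3 * \<beta>\<^sup>2 \<le> \<epsilon>5"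
    and \<eta>: "sqrt 2 * (2 * e / m + \<alpha> + 1) \<le> \<eta>" "sqrt 2 * (4 * e + 1) \<le> \<eta>"
begin

text \<open>The dissipation is measured against \<open>V\<close> through its upper bound by \<open>\<epsilon>3\<close>, the second-order growth
  through its lower bound by \<open>\<epsilon>4\<close>; this is the net decrease per step.\<close>

definition rate :: real where
  "rate = h * \<epsilon>2 / \<epsilon>3 - h\<^sup>2 * \<eta> * \<epsilon>5 / (2 * \<epsilon>4)"

text \<open>Positivity of \<open>\<epsilon>4\<close> hides this relation between the two gains; it is used to bound the dual
  second-order coefficient by \<open>\<eta>\<close>.\<close>

lemma \<beta>_less_\<alpha>: "\<beta> < \<alpha>"
proof -
  have "1 / 2 < \<alpha> / (2 * \<beta>)" using \<epsilon>4 by simp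
  then show ?thesis using pos by (simp add: field_simps)
qed

lemma \<eta>_bounds: "cx + 1 / 4 \<le> \<eta> / 2" "e / m + 1 / 2 \<le> \<eta> / 2" "0 \<le> \<eta>"
proof -
  have s: "7 / 5 \<le> sqrt 2" by (rule real_le_rsqrt) (simp add: power2_eq_square)
  have em: "0 \<le> e / m" using weight(1) pos by simp
  have "7 / 5 * (4 * e + 1) \<le> sqrt 2 * (4 * e + 1)"
    using s weight(1) by (intro mult_right_mono) auto
  then have 1: "7 / 5 * (4 * e + 1) \<le> \<eta>" using \<eta>(2) by linarith
  have "7 / 5 * (2 * e / m + \<alpha> + 1) \<le> sqrt 2 * (2 * e / m + \<alpha> + 1)"
    using s em pos by (intro mult_right_mono) auto
  then have 2: "7 / 5 * (2 * e / m + \<alpha> + 1) \<le> \<eta>" using \<eta>(1) by linarith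
  show "cx + 1 / 4 \<le> \<eta> / 2" using 1 weight(1) by (simp add: cx_def)
  show "e / m + 1 / 2 \<le> \<eta> / 2" using 2 em pos by simp
  have "0 \<le> 7 / 5 * (4 * e + 1)" using weight(1) by simp
  then show "0 \<le> \<eta>" using 1 by (rule order_trans)
qed

text \<open>The coefficient \<open>cv\<close> contains \<open>\<alpha> / (2 * \<beta>)\<close>, which \<open>\<eta> / 2\<close> need not dominate when \<open>\<beta>\<close> is small. It
  occurs only multiplied by \<open>\<beta>\<^sup>2\<close>, however, and contributes \<open>\<alpha> * \<beta> / 2 \<le> \<alpha>\<^sup>2 / 2\<close>, which is covered by the
  room of \<open>1 / 4\<close> between \<open>cx\<close> and \<open>\<eta> / 2\<close>.\<close>

lemma quadratic_coefficients:
  shows "cx * (3 * (\<alpha>\<^sup>2 * r\<^sup>2 + K\<^sup>2)) + cv * \<beta>\<^sup>2 * r\<^sup>2 \<le> \<eta> / 2 * \<epsilon>5"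
    and "cx * (3 * \<beta>\<^sup>2) \<le> \<eta> / 2 * \<epsilon>5"
    and "(cx * (2 * \<alpha>\<^sup>2) + cv * \<beta>\<^sup>2) * r\<^sup>2 \<le> \<eta> / 2 * ((2 * \<alpha>\<^sup>2 + \<beta>\<^sup>2) * r\<^sup>2)"
    and "2 * cx \<le> \<eta> / 2 * 2"
proof -
  define k where "k = \<eta> / 2"
  have k: "cx \<le> k - 1 / 4" "e / m + 1 / 2 \<le> k" "0 \<le> k"
    using \<eta>_bounds by (simp_all add: k_def)
  have cx0: "0 \<le> cx" using weight(1) by (simp add: cx_def)
  have ab: "\<alpha> / (2 * \<beta>) * \<beta>\<^sup>2 \<le> \<alpha>\<^sup>2 / 2"
  proof -
    have "\<alpha> / (2 * \<beta>) * \<beta>\<^sup>2 = \<alpha> * \<beta> / 2" using pos by (simp add: power2_eq_square)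
    also have "\<dots> \<le> \<alpha> * \<alpha> / 2" using pos \<beta>_less_\<alpha> by simp
    finally show ?thesis by (simp add: power2_eq_square)
  qed
  have cv: "cv * \<beta>\<^sup>2 \<le> k * \<beta>\<^sup>2 + \<alpha>\<^sup>2 / 2"
  proof -
    have "cv * \<beta>\<^sup>2 = (e / m + 1 / 2) * \<beta>\<^sup>2 + \<alpha> / (2 * \<beta>) * \<beta>\<^sup>2"
      by (simp only: cv_def distrib_right)
    also have "\<dots> \<le> k * \<beta>\<^sup>2 + \<alpha>\<^sup>2 / 2" by (intro add_mono mult_right_mono k(2) ab) simp
    finally show ?thesis .
  qed
  have ca: "cx * \<alpha>\<^sup>2 \<le> (k - 1 / 4) * \<alpha>\<^sup>2" by (intro mult_right_mono k(1)) simp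
  have cK: "cx * K\<^sup>2 \<le> k * K\<^sup>2" using k(1) by (intro mult_right_mono) auto
  have noise: "cx * (2 * \<alpha>\<^sup>2) + cv * \<beta>\<^sup>2 \<le> k * (2 * \<alpha>\<^sup>2 + \<beta>\<^sup>2)"
    using cv ca by (simp add: algebra_simps)
  have det: "cx * (3 * \<alpha>\<^sup>2) + cv * \<beta>\<^sup>2 \<le> k * (3 * \<alpha>\<^sup>2 + \<beta>\<^sup>2)"
  proof -
    have "cx * (3 * \<alpha>\<^sup>2) + cv * \<beta>\<^sup>2 = 3 * (cx * \<alpha>\<^sup>2) + cv * \<beta>\<^sup>2" by simp
    also have "\<dots> \<le> 3 * ((k - 1 / 4) * \<alpha>\<^sup>2) + (k * \<beta>\<^sup>2 + \<alpha>\<^sup>2 / 2)" using cv ca by linarith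
    also have "\<dots> = k * (3 * \<alpha>\<^sup>2 + \<beta>\<^sup>2) - \<alpha>\<^sup>2 / 4" by (simp add: algebra_simps)
    finally show ?thesis using zero_le_power2[of \<alpha>] by linarith
  qed
  show "cx * (3 * (\<alpha>\<^sup>2 * r\<^sup>2 + K\<^sup>2)) + cv * \<beta>\<^sup>2 * r\<^sup>2 \<le> \<eta> / 2 * \<epsilon>5"
  proof -
    have "cx * (3 * (\<alpha>\<^sup>2 * r\<^sup>2 + K\<^sup>2)) + cv * \<beta>\<^sup>2 * r\<^sup>2
        = (cx * (3 * \<alpha>\<^sup>2) + cv * \<beta>\<^sup>2) * r\<^sup>2 + 3 * (cx * K\<^sup>2)" by (simp add: algebra_simps)
    also have "\<dots> \<le> k * (3 * \<alpha>\<^sup>2 + \<beta>\<^sup>2) * r\<^sup>2 + 3 * (k * K\<^sup>2)"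
      by (intro add_mono mult_right_mono mult_left_mono det cK) auto
    also have "\<dots> = k * (\<beta>\<^sup>2 * r\<^sup>2 + 3 * \<alpha>\<^sup>2 * r\<^sup>2 + 3 * K\<^sup>2)" by (simp add: algebra_simps)
    also have "\<dots> \<le> k * \<epsilon>5" by (intro mult_left_mono \<epsilon>5 k)
    finally show ?thesis by (simp only: k_def)
  qed
  show "cx * (3 * \<beta>\<^sup>2) \<le> \<eta> / 2 * \<epsilon>5"
  proof -
    have "cx * (3 * \<beta>\<^sup>2) \<le> k * (3 * \<beta>\<^sup>2)" using k(1) by (intro mult_right_mono) auto
    also have "\<dots> \<le> k * \<epsilon>5" by (intro mult_left_mono \<epsilon>5 k)
    finally show ?thesis by (simp only: k_def)
  qed
  show "(cx * (2 * \<alpha>\<^sup>2) + cv * \<beta>\<^sup>2) * r\<^sup>2 \<le> \<eta> / 2 * ((2 * \<alpha>\<^sup>2 + \<beta>\<^sup>2) * r\<^sup>2)"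
    using mult_right_mono[OF noise, of "r\<^sup>2"] by (simp add: k_def mult.assoc)
  show "2 * cx \<le> \<eta> / 2 * 2" using k(1) by (simp add: k_def)
qed

lemma V_bounds:
  "\<epsilon>4 * ((norm (dev x))\<^sup>2 + (norm (T w))\<^sup>2) \<le> V x w"
  "V x w \<le> \<epsilon>3 * ((norm (dev x))\<^sup>2 + (norm (T w))\<^sup>2)"
proof -
  have "\<epsilon>4 * ((norm (dev x))\<^sup>2 + (norm (T w))\<^sup>2)
      \<le> (e - 1 / 2) * (norm (dev x))\<^sup>2 + (\<alpha> / (2 * \<beta>) - 1 / 2) * (norm (T w))\<^sup>2"
    unfolding distrib_left by (intro add_mono mult_right_mono \<epsilon>4) auto
  then show "\<epsilon>4 * ((norm (dev x))\<^sup>2 + (norm (T w))\<^sup>2) \<le> V x w" using V_lower by (rule order_trans)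
  have "(e + 1 / 2) * (norm (dev x))\<^sup>2 + (e / m + \<alpha> / (2 * \<beta>) + 1 / 2) * (norm (T w))\<^sup>2
      \<le> \<epsilon>3 * ((norm (dev x))\<^sup>2 + (norm (T w))\<^sup>2)"
    unfolding distrib_left by (intro add_mono mult_right_mono \<epsilon>3) auto
  with V_upper show "V x w \<le> \<epsilon>3 * ((norm (dev x))\<^sup>2 + (norm (T w))\<^sup>2)" by (rule order_trans)
qed

lemma \<epsilon>3_pos: "0 < \<epsilon>3"
  using \<epsilon>3(1) weight(1) by linarith

text \<open>The pathwise inequality behind the theorem: contraction of \<open>V\<close>, plus the squared noise, plus a term
  linear in the noise.\<close>

lemma V_contracts:
  "V (x - h *\<^sub>R (drift x w + (\<alpha> *\<^sub>R T \<xi> + \<zeta>))) (w + (h * \<beta>) *\<^sub>R (x + \<xi>)) \<le> (1 - rate) * V x w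
    + h\<^sup>2 * (\<eta> / 2) * ((2 * \<alpha>\<^sup>2 + \<beta>\<^sup>2) * r\<^sup>2 * (norm \<xi>)\<^sup>2 + 2 * (norm \<zeta>)\<^sup>2)
    + (grad_weight h x w \<bullet> \<zeta> + quant_weight h x w \<bullet> \<xi>)"
proof -
  define p where "p = (norm (dev x))\<^sup>2"
  define t where "t = (norm (T w))\<^sup>2"
  have pt: "0 \<le> p" "0 \<le> t" by (simp_all add: p_def t_def)
  have V: "\<epsilon>4 * (p + t) \<le> V x w" "V x w \<le> \<epsilon>3 * (p + t)"
    using V_bounds[of x w] by (simp_all add: p_def t_def)
  have dissipation: "h * \<epsilon>2 / \<epsilon>3 * V x w \<le> h * (e * \<nu> * p + \<beta> / 2 * t)"
  proof -
    have "h * \<epsilon>2 / \<epsilon>3 * V x w \<le> h * \<epsilon>2 / \<epsilon>3 * (\<epsilon>3 * (p + t))"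
      using h \<epsilon>2(1) \<epsilon>3_pos by (intro mult_left_mono V(2)) simp
    also have "\<dots> = h * (\<epsilon>2 * p + \<epsilon>2 * t)" using \<epsilon>3_pos by (simp add: distrib_left)
    also have "\<dots> \<le> h * (e * \<nu> * p + \<beta> / 2 * t)"
      using pt by (intro mult_left_mono[OF _ h] add_mono mult_right_mono \<epsilon>2)
    finally show ?thesis .
  qed
  have quadratic: "h\<^sup>2 * ((cx * (3 * (\<alpha>\<^sup>2 * r\<^sup>2 + K\<^sup>2)) + cv * \<beta>\<^sup>2 * r\<^sup>2) * p + cx * (3 * \<beta>\<^sup>2) * t)
      \<le> h\<^sup>2 * \<eta> * \<epsilon>5 / (2 * \<epsilon>4) * V x w"
  proof -
    have \<epsilon>5_nonneg: "0 \<le> \<epsilon>5" using \<epsilon>5(2) zero_le_power2[of \<beta>] by linarith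
    have "h\<^sup>2 * ((cx * (3 * (\<alpha>\<^sup>2 * r\<^sup>2 + K\<^sup>2)) + cv * \<beta>\<^sup>2 * r\<^sup>2) * p + cx * (3 * \<beta>\<^sup>2) * t)
        \<le> h\<^sup>2 * (\<eta> / 2 * \<epsilon>5 * p + \<eta> / 2 * \<epsilon>5 * t)"
      using pt by (intro mult_left_mono[OF _ zero_le_power2] add_mono mult_right_mono quadratic_coefficients(1,2))
    also have "\<dots> = h\<^sup>2 * \<eta> * \<epsilon>5 / (2 * \<epsilon>4) * (\<epsilon>4 * (p + t))"
      using \<epsilon>4(1) by (simp add: field_simps)
    also have "\<dots> \<le> h\<^sup>2 * \<eta> * \<epsilon>5 / (2 * \<epsilon>4) * V x w"
      using \<epsilon>4(1) \<eta>_bounds(3) \<epsilon>5_nonneg by (intro mult_left_mono V(1)) simp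
    finally show ?thesis .
  qed
  have noise: "h\<^sup>2 * ((cx * (2 * \<alpha>\<^sup>2) + cv * \<beta>\<^sup>2) * r\<^sup>2 * (norm \<xi>)\<^sup>2 + 2 * cx * (norm \<zeta>)\<^sup>2)
      \<le> h\<^sup>2 * (\<eta> / 2) * ((2 * \<alpha>\<^sup>2 + \<beta>\<^sup>2) * r\<^sup>2 * (norm \<xi>)\<^sup>2 + 2 * (norm \<zeta>)\<^sup>2)"
  proof -
    have "h\<^sup>2 * ((cx * (2 * \<alpha>\<^sup>2) + cv * \<beta>\<^sup>2) * r\<^sup>2 * (norm \<xi>)\<^sup>2 + 2 * cx * (norm \<zeta>)\<^sup>2)
        \<le> h\<^sup>2 * (\<eta> / 2 * ((2 * \<alpha>\<^sup>2 + \<beta>\<^sup>2) * r\<^sup>2) * (norm \<xi>)\<^sup>2 + \<eta> / 2 * 2 * (norm \<zeta>)\<^sup>2)"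
      by (intro mult_left_mono[OF _ zero_le_power2] add_mono mult_right_mono quadratic_coefficients(3,4)) auto
    then show ?thesis by (simp only: distrib_left mult.assoc)
  qed
  have "(1 - rate) * V x w
      = V x w - h * \<epsilon>2 / \<epsilon>3 * V x w + h\<^sup>2 * \<eta> * \<epsilon>5 / (2 * \<epsilon>4) * V x w"
    unfolding rate_def by (simp only: left_diff_distrib mult_1)
  then show ?thesis
    using V_step[OF h, of x w \<xi> \<zeta>, folded p_def t_def] dissipation quadratic noise by linarith
qed

lemma continuous_dev: "continuous_on UNIV dev"
proof -
  have "dev = (\<lambda>x. x - closest_point S x)" by (simp add: fun_eq_iff dev_def)
  then show ?thesis using continuous_on_closest_point[OF S(2,1,3)]
    by (simp add: continuous_on_diff)
qed

lemma continuous_\<Phi>: "continuous_on UNIV \<Phi>"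
proof -
  have "K-lipschitz_on UNIV \<Phi>"
    using lipschitz pos by (intro lipschitz_onI) (auto simp: dist_norm)
  then show ?thesis by (rule lipschitz_on_continuous_on)
qed

lemma measurable_T: "f \<in> borel_measurable G \<Longrightarrow> (\<lambda>\<omega>. T (f \<omega>)) \<in> borel_measurable G"
  by (rule borel_measurable_continuous_on
      [OF linear_continuous_on[OF linear_conv_bounded_linear[THEN iffD1, OF linear_T]]])

text \<open>Measurability is asked of \<open>T \<circ> W\<close> because in the algorithm this is the dual iterate up to a constant,
  which is known at the time of the step.\<close>

lemma measurable_weights:
  assumes X: "X \<in> borel_measurable G" and W: "(\<lambda>\<omega>. T (W \<omega>)) \<in> borel_measurable G"
  shows "(\<lambda>\<omega>. grad_weight h (X \<omega>) (W \<omega>)) \<in> borel_measurable G"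
    and "(\<lambda>\<omega>. quant_weight h (X \<omega>) (W \<omega>)) \<in> borel_measurable G"
proof -
  note [measurable] = borel_measurable_continuous_on[OF continuous_dev X]
    borel_measurable_continuous_on[OF continuous_\<Phi> X] W measurable_T[OF X]
    measurable_T[OF W] measurable_T[OF measurable_T[OF X]]
  show [measurable]: "(\<lambda>\<omega>. grad_weight h (X \<omega>) (W \<omega>)) \<in> borel_measurable G"
    unfolding grad_weight_def drift_def by measurable
  show "(\<lambda>\<omega>. quant_weight h (X \<omega>) (W \<omega>)) \<in> borel_measurable G"
    unfolding quant_weight_def
    by (intro borel_measurable_add borel_measurable_scaleR borel_measurable_const measurable_T X W
        \<open>(\<lambda>\<omega>. grad_weight h (X \<omega>) (W \<omega>)) \<in> borel_measurable G\<close>)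
qed

context
  fixes M :: "'w measure" and X W :: "'w \<Rightarrow> 'a"
  assumes M: "prob_space M" and X: "square_integrable M X" and W: "square_integrable M W"
begin

lemma square_integrable_T:
  "square_integrable M f \<Longrightarrow> square_integrable M (\<lambda>\<omega>. T (f \<omega>))"
  by (rule square_integrable_linear[OF _ linear_T])

lemma square_integrable_dev: "square_integrable M (\<lambda>\<omega>. dev (X \<omega>))"
proof -
  interpret prob_space M by (rule M)
  let ?c = "closest_point S 0"
  have "square_integrable M (\<lambda>\<omega>. X \<omega> - ?c)"
    by (rule square_integrable_diff[OF X square_integrable_const[OF finite_measure_axioms]])
  then show ?thesis
  proof (rule square_integrable_bound)
    show "(\<lambda>\<omega>. dev (X \<omega>)) \<in> borel_measurable M"
      by (rule borel_measurable_continuous_on[OF continuous_dev square_integrable_measurable[OF X]])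
    show "norm (dev (X \<omega>)) \<le> 1 * norm (X \<omega> - ?c)" for \<omega>
      using closest_point_le[OF S(1) closest_in[of 0], of "X \<omega>"] by (simp only: dev_def dist_norm mult_1)
  qed
qed

lemma square_integrable_drift: "square_integrable M (\<lambda>\<omega>. drift (X \<omega>) (W \<omega>))"
proof -
  have \<Phi>: "(\<lambda>\<omega>. \<Phi> (X \<omega>) - \<Phi>0) \<in> borel_measurable M"
    by (intro borel_measurable_diff borel_measurable_const
        borel_measurable_continuous_on[OF continuous_\<Phi> square_integrable_measurable[OF X]])
  show ?thesis
    unfolding drift_def
    by (intro square_integrable_add square_integrable_scaleR square_integrable_T X W
        square_integrable_bound[OF square_integrable_dev \<Phi> norm_\<Phi>_le])
qed

lemma square_integrable_weights:
  "square_integrable M (\<lambda>\<omega>. grad_weight h (X \<omega>) (W \<omega>))"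
  "square_integrable M (\<lambda>\<omega>. quant_weight h (X \<omega>) (W \<omega>))"
  unfolding quant_weight_def grad_weight_def
  by (intro square_integrable_add square_integrable_diff square_integrable_scaleR square_integrable_T
      square_integrable_dev square_integrable_drift X W)+

lemma integrable_V: "integrable M (\<lambda>\<omega>. V (X \<omega>) (W \<omega>))"
proof -
  have sq: "integrable M (\<lambda>\<omega>. (norm (f \<omega>))\<^sup>2)" if "square_integrable M f" for f :: "'w \<Rightarrow> 'a"
    using that by (simp add: square_integrable_def)
  show ?thesis
    unfolding V_def
    by (intro Bochner_Integration.integrable_add integrable_mult_right sq square_integrable_dev
        square_integrable_inner square_integrable_T X W)
qed

lemma expected_V_contracts:
  assumes sub: "subalgebra M G"
    and adapted: "X \<in> borel_measurable G" "(\<lambda>\<omega>. T (W \<omega>)) \<in> borel_measurable G"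
    and \<xi>: "square_integrable M \<xi>"
      "\<And>U. square_integrable M U \<Longrightarrow> U \<in> borel_measurable G \<Longrightarrow> (\<integral>\<omega>. U \<omega> \<bullet> \<xi> \<omega> \<partial>M) = 0"
      "(\<integral>\<omega>. (norm (\<xi> \<omega>))\<^sup>2 \<partial>M) \<le> s\<xi>"
    and \<zeta>: "square_integrable M \<zeta>"
      "\<And>U. square_integrable M U \<Longrightarrow> U \<in> borel_measurable G \<Longrightarrow> (\<integral>\<omega>. U \<omega> \<bullet> \<zeta> \<omega> \<partial>M) = 0"
      "(\<integral>\<omega>. (norm (\<zeta> \<omega>))\<^sup>2 \<partial>M) \<le> s\<zeta>"
    and X': "\<And>\<omega>. \<omega> \<in> space M \<Longrightarrow>
      X' \<omega> = X \<omega> - h *\<^sub>R (drift (X \<omega>) (W \<omega>) + (\<alpha> *\<^sub>R T (\<xi> \<omega>) + \<zeta> \<omega>))"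
    and W': "\<And>\<omega>. \<omega> \<in> space M \<Longrightarrow> W' \<omega> = W \<omega> + (h * \<beta>) *\<^sub>R (X \<omega> + \<xi> \<omega>)"
    and sq': "integrable M (\<lambda>\<omega>. V (X' \<omega>) (W' \<omega>))"
  shows "(\<integral>\<omega>. V (X' \<omega>) (W' \<omega>) \<partial>M) \<le> (1 - rate) * (\<integral>\<omega>. V (X \<omega>) (W \<omega>) \<partial>M)
    + h\<^sup>2 * (\<eta> / 2) * ((2 * \<alpha>\<^sup>2 + \<beta>\<^sup>2) * r\<^sup>2 * s\<xi> + 2 * s\<zeta>)"
proof -
  let ?g = "\<lambda>\<omega>. grad_weight h (X \<omega>) (W \<omega>)" and ?q = "\<lambda>\<omega>. quant_weight h (X \<omega>) (W \<omega>)"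
  let ?a = "h\<^sup>2 * (\<eta> / 2)" and ?b = "(2 * \<alpha>\<^sup>2 + \<beta>\<^sup>2) * r\<^sup>2"
  have int: "integrable M (\<lambda>\<omega>. (1 - rate) * V (X \<omega>) (W \<omega>))"
    "integrable M (\<lambda>\<omega>. ?b * (norm (\<xi> \<omega>))\<^sup>2)" "integrable M (\<lambda>\<omega>. 2 * (norm (\<zeta> \<omega>))\<^sup>2)"
    "integrable M (\<lambda>\<omega>. ?g \<omega> \<bullet> \<zeta> \<omega>)" "integrable M (\<lambda>\<omega>. ?q \<omega> \<bullet> \<xi> \<omega>)"
    using \<xi>(1) \<zeta>(1) integrable_V
    by (auto simp: square_integrable_def intro!: square_integrable_inner[OF square_integrable_weights(1) \<zeta>(1)]
        square_integrable_inner[OF square_integrable_weights(2) \<xi>(1)])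
  let ?R = "\<lambda>\<omega>. (1 - rate) * V (X \<omega>) (W \<omega>) + ?a * (?b * (norm (\<xi> \<omega>))\<^sup>2 + 2 * (norm (\<zeta> \<omega>))\<^sup>2)
    + (?g \<omega> \<bullet> \<zeta> \<omega> + ?q \<omega> \<bullet> \<xi> \<omega>)"
  have intN: "integrable M (\<lambda>\<omega>. ?b * (norm (\<xi> \<omega>))\<^sup>2 + 2 * (norm (\<zeta> \<omega>))\<^sup>2)"
    by (intro Bochner_Integration.integrable_add int)
  have intR: "integrable M ?R"
    by (intro Bochner_Integration.integrable_add int integrable_mult_right intN)
  have "(\<integral>\<omega>. V (X' \<omega>) (W' \<omega>) \<partial>M) \<le> (\<integral>\<omega>. ?R \<omega> \<partial>M)"
  proof (rule integral_mono[OF sq' intR])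
    fix \<omega> assume "\<omega> \<in> space M"
    then show "V (X' \<omega>) (W' \<omega>) \<le> ?R \<omega>"
      using V_contracts[of "X \<omega>" "W \<omega>" "\<xi> \<omega>" "\<zeta> \<omega>"] by (simp only: X' W')
  qed
  also have "\<dots> = (1 - rate) * (\<integral>\<omega>. V (X \<omega>) (W \<omega>) \<partial>M)
      + ?a * (?b * (\<integral>\<omega>. (norm (\<xi> \<omega>))\<^sup>2 \<partial>M) + 2 * (\<integral>\<omega>. (norm (\<zeta> \<omega>))\<^sup>2 \<partial>M))
      + ((\<integral>\<omega>. ?g \<omega> \<bullet> \<zeta> \<omega> \<partial>M) + (\<integral>\<omega>. ?q \<omega> \<bullet> \<xi> \<omega> \<partial>M))"
    using Bochner_Integration.integral_add[OF Bochner_Integration.integrable_add[OF int(1)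
        integrable_mult_right[OF intN, of ?a]] Bochner_Integration.integrable_add[OF int(4,5)]]
      Bochner_Integration.integral_add[OF int(1) integrable_mult_right[OF intN, of ?a]]
      Bochner_Integration.integral_add[OF int(2,3)] Bochner_Integration.integral_add[OF int(4,5)]
    by simp
  also have "\<dots> \<le> (1 - rate) * (\<integral>\<omega>. V (X \<omega>) (W \<omega>) \<partial>M) + ?a * (?b * s\<xi> + 2 * s\<zeta>)"
  proof -
    have zero: "(\<integral>\<omega>. ?g \<omega> \<bullet> \<zeta> \<omega> \<partial>M) = 0" "(\<integral>\<omega>. ?q \<omega> \<bullet> \<xi> \<omega> \<partial>M) = 0"
      by (intro \<zeta>(2) \<xi>(2) square_integrable_weights measurable_weights adapted)+
    have "?a * (?b * (\<integral>\<omega>. (norm (\<xi> \<omega>))\<^sup>2 \<partial>M) + 2 * (\<integral>\<omega>. (norm (\<zeta> \<omega>))\<^sup>2 \<partial>M)) \<le> ?a * (?b * s\<xi> + 2 * s\<zeta>)"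
      using \<eta>_bounds(3) \<xi>(3) \<zeta>(3) by (intro mult_left_mono add_mono) auto
    then show ?thesis unfolding zero by simp
  qed
  finally show ?thesis .
qed

end

end

section \<open>From one step to the limit\<close>

lemma affine_recursion_le:
  fixes a :: "nat \<Rightarrow> real"
  assumes step: "\<And>k. a (Suc k) \<le> (1 - u) * a k + c" and u: "0 < u" "u \<le> 1" and c: "0 \<le> c"
  shows "a k \<le> (1 - u) ^ k * a 0 + c / u"
proof (induction k)
  case 0
  then show ?case using u c by simp
next
  case (Suc k)
  have "a (Suc k) \<le> (1 - u) * ((1 - u) ^ k * a 0 + c / u) + c"
    using step[of k] mult_left_mono[OF Suc, of "1 - u"] u by linarith
  also have "\<dots> = (1 - u) ^ Suc k * a 0 + c / u" using u by (simp add: field_simps)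
  finally show ?case .
qed

text \<open>From \<open>1 - u \<le> (1 - u / 2)\<^sup>2\<close>: a rate for second moments becomes half of that rate for first moments.\<close>

lemma sqrt_geometric_le:
  assumes "0 \<le> u" "u \<le> 1" "0 \<le> a" "0 \<le> c"
  shows "sqrt ((1 - u) ^ k * a + c) \<le> sqrt a * (1 - u / 2) ^ k + sqrt c"
proof -
  have "(1 - u) ^ k * a \<le> ((1 - u / 2) ^ k)\<^sup>2 * a"
  proof (intro mult_right_mono assms)
    have "1 - u \<le> (1 - u / 2)\<^sup>2" by (simp add: power2_eq_square algebra_simps)
    then have "(1 - u) ^ k \<le> ((1 - u / 2)\<^sup>2) ^ k" using assms by (intro power_mono) auto
    then show "(1 - u) ^ k \<le> ((1 - u / 2) ^ k)\<^sup>2" by (simp only: power_mult[symmetric] mult.commute)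
  qed
  then have "sqrt ((1 - u) ^ k * a + c) \<le> sqrt (((1 - u / 2) ^ k)\<^sup>2 * a + c)"
    by (intro real_sqrt_le_mono) simp
  also have "\<dots> \<le> sqrt (((1 - u / 2) ^ k)\<^sup>2 * a) + sqrt c"
    using assms by (intro sqrt_add_le_add_sqrt) auto
  also have "\<dots> = sqrt a * (1 - u / 2) ^ k + sqrt c"
    using assms by (simp add: real_sqrt_mult mult.commute)
  finally show ?thesis .
qed

text \<open>The upper bound on \<open>h\<close> is more than a stability condition: being positive, it forces \<open>\<epsilon>4 > 0\<close>. It also
  implies \<open>3 * h * \<beta> < 1\<close>, so that the contraction factor per step is nonnegative and the affine
  recursion may be iterated.\<close>

lemma step_size_bounds:
  fixes \<beta> \<epsilon>2 \<epsilon>3 \<epsilon>4 \<epsilon>5 \<eta> h :: real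
  assumes \<beta>: "0 < \<beta>" and \<epsilon>2: "0 < \<epsilon>2" "\<epsilon>2 \<le> \<beta> / 2" and \<epsilon>3: "1 \<le> \<epsilon>3" "\<epsilon>4 \<le> \<epsilon>3"
    and \<epsilon>5: "3 * \<beta>\<^sup>2 \<le> \<epsilon>5" and \<eta>: "1 \<le> \<eta>"
    and h: "0 < h" "h < 2 * \<epsilon>2 * \<epsilon>4 / (\<eta> * \<epsilon>3 * \<epsilon>5)"
  shows "0 < \<epsilon>4" "0 < 2 * \<epsilon>2 * \<epsilon>4 - h * \<eta> * \<epsilon>3 * \<epsilon>5" "h * \<epsilon>2 / \<epsilon>3 \<le> 1"
proof -
  have \<epsilon>5_pos: "0 < \<epsilon>5" using \<epsilon>5 \<beta> by (smt (verit) zero_less_power)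
  have D: "0 < \<eta> * \<epsilon>3 * \<epsilon>5" using \<eta> \<epsilon>3(1) \<epsilon>5_pos by simp
  have less: "h * (\<eta> * \<epsilon>3 * \<epsilon>5) < 2 * \<epsilon>2 * \<epsilon>4" using h(2) D by (simp add: pos_less_divide_eq)
  then show "0 < 2 * \<epsilon>2 * \<epsilon>4 - h * \<eta> * \<epsilon>3 * \<epsilon>5" by (simp add: mult.assoc)
  have "0 < h * (\<eta> * \<epsilon>3 * \<epsilon>5)" using h(1) D by simp
  with less have "0 < 2 * \<epsilon>2 * \<epsilon>4" by linarith
  then show "0 < \<epsilon>4" using \<epsilon>2(1) by (simp add: zero_less_mult_iff)
  have "\<epsilon>3 * (h * (3 * \<beta>\<^sup>2)) \<le> \<epsilon>3 * (h * (\<eta> * \<epsilon>5))"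
  proof -
    have "3 * \<beta>\<^sup>2 \<le> \<eta> * \<epsilon>5" using \<epsilon>5 \<eta> \<epsilon>5_pos mult_right_mono[of 1 \<eta> \<epsilon>5] by linarith
    then show ?thesis using \<epsilon>3(1) h(1) by (intro mult_left_mono) auto
  qed
  also have "\<dots> = h * (\<eta> * \<epsilon>3 * \<epsilon>5)" by simp
  also have "\<dots> < 2 * \<epsilon>2 * \<epsilon>4" by (rule less)
  also have "\<dots> \<le> \<beta> * \<epsilon>3"
    using \<epsilon>2 \<epsilon>3 \<beta> \<open>0 < \<epsilon>4\<close> by (intro mult_mono) auto
  finally have "\<epsilon>3 * \<beta> * (h * (3 * \<beta>)) < \<epsilon>3 * \<beta> * 1" by (simp add: power2_eq_square mult_ac)
  then have "h * (3 * \<beta>) < 1" using \<epsilon>3(1) \<beta> by (simp only: mult_less_cancel_left_pos mult_pos_pos zero_less_one)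
  moreover have "h * \<epsilon>2 \<le> h * (\<beta> / 2)" using h(1) \<epsilon>2(2) by (intro mult_left_mono) auto
  moreover have "0 < h * \<beta>" using h(1) \<beta> by simp
  ultimately have "h * \<epsilon>2 \<le> \<epsilon>3" using \<epsilon>3(1) by simp
  then show "h * \<epsilon>2 / \<epsilon>3 \<le> 1" using \<epsilon>3(1) by simp
qed

theorem theorem1:
  fixes f :: "'n::finite \<Rightarrow> real ^ 'd::finite \<Rightarrow> real"
    and Lf :: "'n \<Rightarrow> real"
    and a L :: "real ^ 'n ^ 'n"
    and M :: "'w measure" and \<F> :: "nat \<Rightarrow> 'w measure"
    and x v q g \<zeta> :: "nat \<Rightarrow> 'w \<Rightarrow> real ^ 'd ^ 'n"
    and x0 :: "real ^ 'd ^ 'n"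
    and Xs :: "(real ^ 'd) set" and XXs :: "(real ^ 'd ^ 'n) set"
    and fsum :: "real ^ 'd \<Rightarrow> real" and F :: "real ^ 'd ^ 'n \<Rightarrow> real"
    and l u \<Delta> \<alpha> \<beta> h \<nu> \<sigma> Lmax n d \<rho>L \<rho>2 :: real and b :: nat
    and \<nu>1 \<epsilon>1 \<epsilon>2 \<epsilon>3 \<epsilon>4 \<epsilon>5 \<eta> A B \<rho> :: real
  \<comment> \<open>the problem\<close>
  assumes n: "n = real CARD('n)" and n_ge_2: "2 \<le> CARD('n)" and d: "d = real CARD('d)"
    and fsum: "fsum = (\<lambda>z. \<Sum>i\<in>UNIV. f i z)"
    and F: "F = (\<lambda>X. \<Sum>i\<in>UNIV. f i (X $ i))"
    and Xs: "Xs = argmin_set fsum" and XXs: "XXs = vec ` Xs"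
    and Xs_nonempty: "Xs \<noteq> {}" and Xs_convex: "convex Xs"
    and f_diff: "\<And>i z. f i differentiable (at z)"
    and f_C1: "\<And>i. continuous_on UNIV (grad (f i))"
    and Lf_pos: "\<And>i. 0 < Lf i"
    and f_lipschitz: "\<And>i y z. norm (grad (f i) y - grad (f i) z) \<le> Lf i * norm (y - z)"
    and Lmax: "Lmax = Max (range Lf)"
    and \<nu>_pos: "0 < \<nu>"
    and RSI: "\<And>z. (grad fsum z - grad fsum (closest_point Xs z)) \<bullet> (z - closest_point Xs z)
                 \<ge> \<nu> * (norm (z - closest_point Xs z))\<^sup>2"
    and grad_singleton: "is_singleton (grad F ` XXs)"
  \<comment> \<open>the network\<close>
    and graph: "weighted_undirected a" "graph_connected a"
    and L: "L = laplacian a"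
    and \<rho>L: "\<rho>L = spectral_radius L" and \<rho>2: "\<rho>2 = least_nonzero_eigenvalue L"
  \<comment> \<open>the stochastic algorithm\<close>
    and M: "prob_space M"
    and filt: "filtration (space M) \<F>" "\<And>k. subalgebra M (\<F> k)"
    and adapted: "\<And>k. x k \<in> borel_measurable (\<F> k)" "\<And>k. v k \<in> borel_measurable (\<F> k)"
      "\<And>k. q k \<in> borel_measurable (\<F> (Suc k))" "\<And>k. g k \<in> borel_measurable (\<F> (Suc k))"
    and algorithm: "q_pdgd M L \<alpha> \<beta> h x0 x v q g"
    and stoch_grad: "\<And>k \<omega> i. \<omega> \<in> space M \<Longrightarrow> g k \<omega> $ i = grad (f i) (x k \<omega> $ i) + \<zeta> k \<omega> $ i"
    and \<zeta>_mean: "\<And>k i. cond_mean_zero M (\<F> k) (\<lambda>\<omega>. \<zeta> k \<omega> $ i)"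
    and \<zeta>_var: "\<And>k i. cond_second_moment_le M (\<F> k) (\<lambda>\<omega>. \<zeta> k \<omega> $ i) (\<sigma>\<^sup>2)"
  \<comment> \<open>the quantization\<close>
    and range: "l < u" "1 \<le> b" and \<Delta>: "\<Delta> = quant_step l u b"
    and quantizer: "\<And>k. quantizes M (\<F> k) l u b (x k) (q k)"
    and \<epsilon>_mean: "\<And>k i. cond_mean_zero M (\<F> k) (\<lambda>\<omega>. q k \<omega> $ i - x k \<omega> $ i)"
    and \<epsilon>_var: "\<And>k i. cond_second_moment_le M (\<F> k) (\<lambda>\<omega>. q k \<omega> $ i - x k \<omega> $ i) (d * \<Delta>\<^sup>2 / 4)"
  \<comment> \<open>the constants\<close>
    and \<nu>1: "\<nu>1 = min (\<nu> / (2 * n)) (\<alpha> * \<rho>2 - (2 * n * Lmax\<^sup>2 + \<nu> * Lmax) / \<nu>)"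
    and \<epsilon>1: "\<epsilon>1 = max (1 / \<nu>1 * (Lmax\<^sup>2 / (2 * \<beta>) + \<beta> * \<rho>L)) (1 / 2)"
    and \<epsilon>2: "\<epsilon>2 = min (\<beta> / 2) (\<epsilon>1 * \<nu>1)"
    and \<epsilon>3: "\<epsilon>3 = max (\<epsilon>1 + 1 / 2) (\<epsilon>1 / \<rho>2 + \<alpha> / (2 * \<beta>) + 1 / 2)"
    and \<epsilon>4: "\<epsilon>4 = min (\<epsilon>1 - 1 / 2) (\<alpha> / (2 * \<beta>) - 1 / 2)"
    and \<epsilon>5: "\<epsilon>5 = max (\<beta>\<^sup>2 * \<rho>L\<^sup>2 + 3 * \<alpha>\<^sup>2 * \<rho>L\<^sup>2 + 3 * Lmax\<^sup>2) (3 * \<beta>\<^sup>2)"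
    and \<eta>: "\<eta> = sqrt 2 * max (2 * \<epsilon>1 / \<rho>2 + \<alpha> + 1) (4 * \<epsilon>1 + 1)"
    and A: "A = (\<epsilon>3 * \<eta> * h / (2 * \<epsilon>2 * \<epsilon>4 - h * \<eta> * \<epsilon>3 * \<epsilon>5))
                  * (n * d / 4) * (2 * \<alpha>\<^sup>2 + \<beta>\<^sup>2) * \<rho>L\<^sup>2"
    and B: "B = (\<epsilon>3 * \<eta> * h / (2 * \<epsilon>2 * \<epsilon>4 - h * \<eta> * \<epsilon>3 * \<epsilon>5)) * (2 * n)"
    and \<rho>: "\<rho> = 1 - h * (2 * \<epsilon>2 * \<epsilon>4 - h * \<eta> * \<epsilon>3 * \<epsilon>5) / (4 * \<epsilon>3 * \<epsilon>4)"
  \<comment> \<open>the parameter ranges\<close>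
    and \<alpha>_gt: "\<alpha> > (2 * n * Lmax\<^sup>2 + \<nu> * Lmax) / (\<nu> * \<rho>2)"
    and \<beta>_pos: "0 < \<beta>"
    and h_pos: "0 < h"
    and h_less: "h < min (2 * \<epsilon>2 * \<epsilon>4 / (\<eta> * \<epsilon>3 * \<epsilon>5)) (2 * \<epsilon>3 / \<epsilon>2)"
  shows "\<rho> \<in> {0<..<1} \<and>
    (\<exists>C>0. \<forall>k.
      integrable M (\<lambda>\<omega>. norm (x k \<omega> - closest_point XXs (x k \<omega>))) \<and>
      (\<integral>\<omega>. norm (x k \<omega> - closest_point XXs (x k \<omega>)) \<partial>M)
        \<le> C * \<rho> ^ k + sqrt (A * \<Delta>\<^sup>2 + B * \<sigma>\<^sup>2))"
proof -
  interpret prob_space M by (rule M)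
  let ?T = "kron L :: real ^ 'd ^ 'n \<Rightarrow> real ^ 'd ^ 'n"
  let ?\<Phi> = "stacked_grad f"
  obtain z0 where z0: "z0 \<in> Xs" using Xs_nonempty by blast
  define \<Phi>0 where "\<Phi>0 = ?\<Phi> (vec z0)"
  note sym = laplacian_symmetric[OF graph(1), folded L]
  note adj = kron_self_adjoint[OF sym]
  have n_pos: "0 < n" by (simp add: n)
  have kernel: "{z. ?T z = 0} = range vec"
    using laplacian_kernel[OF graph] by (auto simp: L)
  have kernel_comp: "y \<in> {z. ?T z = 0}\<^sup>\<bottom>" if "(\<Sum>i\<in>UNIV. y $ i) = 0" for y
    using that by (auto simp: kernel orthogonal_comp_def orthogonal_def inner_vec_left)

  have fsum_diff: "fsum differentiable (at z)" for z
    unfolding fsum using f_diff by (intro differentiable_sum) auto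
  have fsum_cont: "continuous_on UNIV fsum"
    using fsum_diff by (intro continuous_at_imp_continuous_on ballI differentiable_imp_continuous_within)
  have Xs_closed: "closed Xs" unfolding Xs by (rule closed_argmin[OF fsum_cont])
  have grad_fsum: "grad fsum z = (\<Sum>i\<in>UNIV. grad (f i) z)" for z
    unfolding fsum by (rule grad_sum) (rule f_diff)
  have grad_F: "grad F = ?\<Phi>"
    unfolding F using f_diff by (intro ext grad_separable)
  have XXs_closed: "closed XXs" unfolding XXs by (rule closed_vec_image[OF Xs_closed])
  have XXs_convex: "convex XXs" unfolding XXs by (rule convex_linear_image[OF linear_vec Xs_convex])
  have XXs_nonempty: "XXs \<noteq> {}" unfolding XXs using Xs_nonempty by simp
  have \<Phi>_XXs: "?\<Phi> z = \<Phi>0" if "z \<in> XXs" for z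
  proof -
    have "vec z0 \<in> XXs" using z0 by (simp add: XXs)
    then show ?thesis
      using grad_singleton that unfolding grad_F \<Phi>0_def is_singleton_def by (metis imageI singletonD)
  qed
  have closest_XXs: "closest_point XXs X = vec (closest_point Xs (mean X))" for X
    unfolding XXs by (rule closest_point_consensus[OF Xs_closed Xs_convex Xs_nonempty])

  have Lmax_ge: "Lf i \<le> Lmax" for i unfolding Lmax by (rule Max_ge) auto
  have Lmax_pos: "0 < Lmax" using Lf_pos Lmax_ge less_le_trans by blast
  have lipschitz: "norm (?\<Phi> X - ?\<Phi> Y) \<le> Lmax * norm (X - Y)" for X Y
    by (rule norm_stacked_grad_diff_le[OF f_lipschitz less_imp_le[OF Lf_pos] Lmax_ge])

  have gap: "\<rho>2 * (norm y)\<^sup>2 \<le> y \<bullet> ?T y" if "y \<in> {z. ?T z = 0}\<^sup>\<bottom>" for y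
    using laplacian_spectral_gap(1)[OF graph] that by (simp add: L \<rho>2)
  obtain y0 :: "real ^ 'd ^ 'n" where y0: "y0 \<in> {z. ?T z = 0}\<^sup>\<bottom>" "y0 \<noteq> 0"
    using exists_disagreement[OF graph n_ge_2] unfolding L by blast
  have \<rho>2_pos: "0 < \<rho>2"
    using laplacian_spectral_gap(2)[OF graph] y0 by (simp add: L \<rho>2)
  have norm_T: "norm (?T X) \<le> \<rho>L * norm X" for X
    unfolding \<rho>L by (rule norm_kron_le_spectral_radius[OF sym])
  have \<rho>L_nonneg: "0 \<le> \<rho>L"
  proof -
    have "0 \<le> \<rho>L * norm y0" using norm_T[of y0] norm_ge_zero order_trans by blast
    then show ?thesis using y0(2) by (simp add: zero_le_mult_iff)
  qed

  have secant: "\<nu>1 * (norm (X - closest_point XXs X))\<^sup>2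
      \<le> \<alpha> * (X \<bullet> ?T X) + (X - closest_point XXs X) \<bullet> (?\<Phi> X - \<Phi>0)" if "0 \<le> \<alpha>" for X
  proof -
    let ?c = "closest_point Xs (mean X)"
    let ?y = "X - vec (mean X)"
    have "?y \<bullet> ?T ?y = X \<bullet> ?T X"
    proof -
      interpret T: linear ?T by (rule linear_kron)
      have "vec (mean X) \<in> {z. ?T z = 0}" unfolding kernel by blast
      then have v: "?T (vec (mean X)) = 0" by simp
      then have "?T ?y = ?T X" by (simp add: T.diff)
      moreover have "vec (mean X) \<bullet> ?T X = 0" using adj[of "vec (mean X)" X] v by simp
      ultimately show ?thesis by (simp add: inner_diff_left)
    qed
    then have "\<rho>2 * (norm ?y)\<^sup>2 \<le> X \<bullet> ?T X"
      using gap[OF kernel_comp[OF sum_deviation_zero[of X]]] by simp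
    from restricted_secant_stacked[where f = f and c = ?c, OF n \<nu>_pos that less_imp_le[OF Lmax_pos] lipschitz _ this]
    have "\<nu>1 * (norm (X - vec ?c))\<^sup>2 \<le> \<alpha> * (X \<bullet> ?T X) + (X - vec ?c) \<bullet> (?\<Phi> X - ?\<Phi> (vec ?c))"
      using RSI[of "mean X"] by (simp add: \<nu>1 grad_fsum)
    moreover have "?\<Phi> (vec ?c) = \<Phi>0"
      using closest_point_in_set[OF Xs_closed Xs_nonempty] by (intro \<Phi>_XXs) (simp add: XXs)
    ultimately show ?thesis by (simp add: closest_XXs)
  qed

  have num_pos: "0 < 2 * n * Lmax\<^sup>2 + \<nu> * Lmax"
    using n_pos Lmax_pos \<nu>_pos by (intro add_pos_pos mult_pos_pos) auto
  have \<alpha>_pos: "0 < \<alpha>"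
  proof -
    have "0 < (2 * n * Lmax\<^sup>2 + \<nu> * Lmax) / (\<nu> * \<rho>2)"
      using num_pos \<nu>_pos \<rho>2_pos by simp
    then show ?thesis using \<alpha>_gt by linarith
  qed
  have \<nu>1_pos: "0 < \<nu>1"
  proof -
    have "(2 * n * Lmax\<^sup>2 + \<nu> * Lmax) / \<nu> < \<alpha> * \<rho>2"
      using \<alpha>_gt \<nu>_pos \<rho>2_pos by (simp add: field_simps)
    then show ?thesis using \<nu>_pos n_pos by (simp add: \<nu>1)
  qed
  have \<epsilon>1_ge: "1 / 2 \<le> \<epsilon>1" by (simp add: \<epsilon>1)
  have \<epsilon>1_weight: "Lmax\<^sup>2 / (2 * \<beta>) + \<beta> * \<rho>L \<le> \<epsilon>1 * \<nu>1"
  proof -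
    have "1 / \<nu>1 * (Lmax\<^sup>2 / (2 * \<beta>) + \<beta> * \<rho>L) * \<nu>1 \<le> \<epsilon>1 * \<nu>1"
      using \<nu>1_pos by (intro mult_right_mono) (simp_all add: \<epsilon>1)
    then show ?thesis using \<nu>1_pos by simp
  qed
  have \<epsilon>2_pos: "0 < \<epsilon>2"
    using \<beta>_pos \<nu>1_pos \<epsilon>1_ge by (simp add: \<epsilon>2)
  have \<epsilon>3_ge: "\<epsilon>1 + 1 / 2 \<le> \<epsilon>3" by (simp add: \<epsilon>3)
  have \<epsilon>4_le: "\<epsilon>4 \<le> \<epsilon>1 - 1 / 2" by (simp add: \<epsilon>4)
  have \<eta>_ge: "1 \<le> \<eta>"
  proof -
    have "1 * 1 \<le> sqrt 2 * max (2 * \<epsilon>1 / \<rho>2 + \<alpha> + 1) (4 * \<epsilon>1 + 1)"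
      using \<epsilon>1_ge by (intro mult_mono) auto
    then show ?thesis by (simp add: \<eta>)
  qed
  have h1: "h < 2 * \<epsilon>2 * \<epsilon>4 / (\<eta> * \<epsilon>3 * \<epsilon>5)" using h_less by simp
  have "\<epsilon>2 \<le> \<beta> / 2" "1 \<le> \<epsilon>3" "\<epsilon>4 \<le> \<epsilon>3" "3 * \<beta>\<^sup>2 \<le> \<epsilon>5"
    using \<epsilon>3_ge \<epsilon>4_le \<epsilon>1_ge by (auto simp: \<epsilon>2 \<epsilon>5)
  note step = step_size_bounds[OF \<beta>_pos \<epsilon>2_pos this \<eta>_ge h_pos h1]

  interpret PD: primal_dual_step ?T ?\<Phi> XXs \<Phi>0 \<alpha> \<beta> \<rho>L \<rho>2 Lmax \<nu>1 \<epsilon>1 h \<epsilon>2 \<epsilon>3 \<epsilon>4 \<epsilon>5 \<eta>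
  proof unfold_locales
    show "?T (y + z) = ?T y + ?T z" "?T (c *\<^sub>R y) = c *\<^sub>R ?T y" for y z c
      by (rule linear_add[OF linear_kron] linear_scale[OF linear_kron])+
    show "y \<bullet> ?T z = ?T y \<bullet> z" for y z by (rule adj)
    show "y \<bullet> ?T y \<le> (norm (?T y))\<^sup>2 / \<rho>2" for y
      by (rule self_adjoint_gap_form_le[OF linear_kron adj \<rho>2_pos gap])
    show "0 \<le> y \<bullet> ?T y" for y unfolding L by (rule laplacian_form_nonneg[OF graph(1)])
    show "?T z = 0" if "z \<in> XXs" for z using that kernel by (auto simp: XXs)
    show "sqrt 2 * (2 * \<epsilon>1 / \<rho>2 + \<alpha> + 1) \<le> \<eta>" "sqrt 2 * (4 * \<epsilon>1 + 1) \<le> \<eta>"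
      unfolding \<eta> by (intro mult_left_mono; simp)+
  qed (use norm_T XXs_closed XXs_convex XXs_nonempty \<Phi>_XXs lipschitz secant
      \<alpha>_pos \<beta>_pos \<rho>2_pos Lmax_pos \<rho>L_nonneg \<epsilon>1_ge \<epsilon>1_weight h_pos \<epsilon>2_pos step(1)
      in \<open>auto simp: \<epsilon>2 \<epsilon>3 \<epsilon>4 \<epsilon>5\<close>)

  have rate: "PD.rate = 2 * (1 - \<rho>)" "0 < PD.rate" "PD.rate \<le> 1"
  proof -
    have \<epsilon>34: "\<epsilon>3 \<noteq> 0" "\<epsilon>4 \<noteq> 0" "0 < \<epsilon>3" using step(1) PD.\<epsilon>3_pos by auto
    show 1: "PD.rate = 2 * (1 - \<rho>)"
      unfolding PD.rate_def \<rho> using \<epsilon>34 by (simp add: field_simps power2_eq_square)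
    have "0 < h * (2 * \<epsilon>2 * \<epsilon>4 - h * \<eta> * \<epsilon>3 * \<epsilon>5) / (4 * \<epsilon>3 * \<epsilon>4)"
      using h_pos step(1,2) \<epsilon>34 by simp
    then show "0 < PD.rate" unfolding 1 \<rho> by simp
    have \<epsilon>5_nonneg: "0 \<le> \<epsilon>5" using PD.\<epsilon>5(2) zero_le_power2[of \<beta>] by linarith
    have "0 \<le> h\<^sup>2 * \<eta> * \<epsilon>5 / (2 * \<epsilon>4)"
      using step(1) PD.\<eta>_bounds(3) \<epsilon>5_nonneg by (intro divide_nonneg_pos mult_nonneg_nonneg) auto
    then show "PD.rate \<le> 1" unfolding PD.rate_def using step(3) by linarith
  qed
  have \<rho>_range: "\<rho> \<in> {0<..<1}" using rate by auto

  \<comment> \<open>The dual iterate is tracked through a preimage \<open>W\<close> under \<open>T\<close> of \<open>v\<close> minus its limit.\<close>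
  have "\<Phi>0 /\<^sub>R \<beta> \<in> range ?T"
  proof -
    have "(\<Sum>i\<in>UNIV. (\<Phi>0 /\<^sub>R \<beta>) $ i) = grad fsum z0 /\<^sub>R \<beta>"
      by (simp add: \<Phi>0_def stacked_grad_def grad_fsum scaleR_sum_right)
    also have "\<dots> = 0" using grad_argmin[OF z0[unfolded Xs] fsum_diff] by simp
    finally show ?thesis
      unfolding self_adjoint_range[OF linear_kron adj] by (rule kernel_comp)
  qed
  then obtain w0 where w0: "?T w0 = \<Phi>0 /\<^sub>R \<beta>" by (metis imageE)
  define W where "W k \<omega> = w0 + (h * \<beta>) *\<^sub>R (\<Sum>j<k. q j \<omega>)" for k \<omega>
  define \<xi> where "\<xi> k \<omega> = q k \<omega> - x k \<omega>" for k \<omega>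
  have W_Suc: "W (Suc k) \<omega> = W k \<omega> + (h * \<beta>) *\<^sub>R (x k \<omega> + \<xi> k \<omega>)" for k \<omega>
    by (simp add: W_def \<xi>_def scaleR_add_right)
  have v_Suc: "v (Suc k) \<omega> = v k \<omega> + (h * \<beta>) *\<^sub>R ?T (q k \<omega>)" if "\<omega> \<in> space M" for k \<omega>
    using algorithm that unfolding q_pdgd_def by (simp add: vec_eq_iff kron_def)
  have TW: "?T (W k \<omega>) = v k \<omega> + \<Phi>0 /\<^sub>R \<beta>" if \<omega>: "\<omega> \<in> space M" for k \<omega>
  proof (induction k)
    case 0
    have "v 0 \<omega> = 0" using algorithm \<omega> by (simp add: q_pdgd_def)
    then show ?case by (simp add: W_def w0)
  next
    case (Suc k)
    have "?T (W (Suc k) \<omega>) = ?T (W k \<omega>) + (h * \<beta>) *\<^sub>R ?T (q k \<omega>)"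
      unfolding W_Suc by (simp add: PD.T.add PD.T.scaleR \<xi>_def)
    then show ?case by (simp add: Suc v_Suc[OF \<omega>])
  qed
  have x_Suc: "x (Suc k) \<omega> = x k \<omega> - h *\<^sub>R (PD.drift (x k \<omega>) (W k \<omega>) + (\<alpha> *\<^sub>R ?T (\<xi> k \<omega>) + \<zeta> k \<omega>))"
    if \<omega>: "\<omega> \<in> space M" for k \<omega>
  proof -
    have "x (Suc k) \<omega> = x k \<omega> - h *\<^sub>R (\<alpha> *\<^sub>R ?T (q k \<omega>) + \<beta> *\<^sub>R v k \<omega> + g k \<omega>)"
      using algorithm \<omega> unfolding q_pdgd_def by (simp add: vec_eq_iff kron_def)
    moreover have "g k \<omega> = ?\<Phi> (x k \<omega>) + \<zeta> k \<omega>"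
      using stoch_grad[OF \<omega>] by (simp add: vec_eq_iff stacked_grad_def)
    moreover have "?T (q k \<omega>) = ?T (x k \<omega>) + ?T (\<xi> k \<omega>)"
      by (simp add: \<xi>_def PD.T.diff)
    moreover have "\<beta> *\<^sub>R ?T (W k \<omega>) = \<beta> *\<^sub>R v k \<omega> + \<Phi>0"
      using \<beta>_pos by (simp add: TW[OF \<omega>] scaleR_add_right)
    ultimately show ?thesis by (simp add: PD.drift_def scaleR_add_right)
  qed

  have adapted_M: "f \<in> borel_measurable (\<F> k) \<Longrightarrow> f \<in> borel_measurable M"
    for k and f :: "'w \<Rightarrow> real ^ 'd ^ 'n"
    by (rule measurable_from_subalg[OF filt(2)])
  have space_\<F>: "space (\<F> k) = space M" for k using filt(2) by (simp add: subalgebra_def)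
  have TW_adapted: "(\<lambda>\<omega>. ?T (W k \<omega>)) \<in> borel_measurable (\<F> k)" for k
  proof -
    have "(\<lambda>\<omega>. v k \<omega> + \<Phi>0 /\<^sub>R \<beta>) \<in> borel_measurable (\<F> k)"
      by (intro borel_measurable_add adapted(2) borel_measurable_const)
    then show ?thesis using TW by (subst measurable_cong) (auto simp: space_\<F>)
  qed
  have \<xi>_measurable: "\<xi> k \<in> borel_measurable M" for k
    unfolding \<xi>_def by (intro borel_measurable_diff adapted_M[OF adapted(3)] adapted_M[OF adapted(1)])
  have \<zeta>_measurable: "\<zeta> k \<in> borel_measurable M" for k
  proof -
    have "(\<lambda>\<omega>. g k \<omega> - ?\<Phi> (x k \<omega>)) \<in> borel_measurable M"
      by (intro borel_measurable_diff adapted_M[OF adapted(4)]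
          borel_measurable_continuous_on[OF PD.continuous_\<Phi> adapted_M[OF adapted(1)]])
    moreover have "\<zeta> k \<omega> = g k \<omega> - ?\<Phi> (x k \<omega>)" if "\<omega> \<in> space M" for \<omega>
      using stoch_grad[OF that] by (simp add: vec_eq_iff stacked_grad_def)
    ultimately show ?thesis by (subst measurable_cong) auto
  qed
  have d_nonneg: "0 \<le> d * \<Delta>\<^sup>2 / 4" by (simp add: d)
  have \<xi>_var: "cond_second_moment_le M (\<F> k) (\<lambda>\<omega>. \<xi> k \<omega> $ i) (d * \<Delta>\<^sup>2 / 4)" for k i
    using \<epsilon>_var by (simp add: \<xi>_def)
  note \<xi>_moment = stacked_second_moment_le[OF M filt(2) \<xi>_measurable \<xi>_var d_nonneg, folded n]
  note \<zeta>_moment = stacked_second_moment_le[OF M filt(2) \<zeta>_measurable \<zeta>_var zero_le_power2, folded n]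
  have \<xi>_orth: "(\<integral>\<omega>. U \<omega> \<bullet> \<xi> k \<omega> \<partial>M) = 0"
    if "square_integrable M U" "U \<in> borel_measurable (\<F> k)" for k U
    by (rule integral_inner_noise[OF M filt(2) that \<xi>_moment(1)]) (unfold \<xi>_def, simp add: \<epsilon>_mean)
  have \<zeta>_orth: "(\<integral>\<omega>. U \<omega> \<bullet> \<zeta> k \<omega> \<partial>M) = 0"
    if "square_integrable M U" "U \<in> borel_measurable (\<F> k)" for k U
    by (rule integral_inner_noise[OF M filt(2) that \<zeta>_moment(1) \<zeta>_mean])

  have sq: "square_integrable M (x k) \<and> square_integrable M (W k)" for k
  proof (induction k)
    case 0
    have "square_integrable M (x 0)"
    proof (rule square_integrable_bound[OF square_integrable_const[OF finite_measure_axioms, of x0]])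
      show "x 0 \<in> borel_measurable M" by (rule adapted_M[OF adapted(1)])
      show "norm (x 0 \<omega>) \<le> 1 * norm x0" if "\<omega> \<in> space M" for \<omega>
        using algorithm that by (simp add: q_pdgd_def)
    qed
    moreover have "square_integrable M (W 0)"
      using square_integrable_const[OF finite_measure_axioms, of w0] by (simp add: W_def[abs_def])
    ultimately show ?case ..
  next
    case (Suc k)
    let ?x' = "\<lambda>\<omega>. x k \<omega> - h *\<^sub>R (PD.drift (x k \<omega>) (W k \<omega>) + (\<alpha> *\<^sub>R ?T (\<xi> k \<omega>) + \<zeta> k \<omega>))"
    have "square_integrable M ?x'"
      using Suc
      by (intro square_integrable_diff square_integrable_scaleR square_integrable_add
          PD.square_integrable_drift[OF M] square_integrable_linear[OF _ linear_kron] \<xi>_moment(1) \<zeta>_moment(1)) auto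
    then have "square_integrable M (x (Suc k))"
      by (rule square_integrable_bound[OF _ adapted_M[OF adapted(1)], where c = 1]) (simp add: x_Suc)
    moreover have "square_integrable M (W (Suc k))"
    proof -
      have "W (Suc k) = (\<lambda>\<omega>. W k \<omega> + (h * \<beta>) *\<^sub>R (x k \<omega> + \<xi> k \<omega>))"
        by (simp add: fun_eq_iff W_Suc)
      then show ?thesis using Suc \<xi>_moment(1)
        by (auto intro!: square_integrable_add square_integrable_scaleR)
    qed
    ultimately show ?case by simp
  qed

  define EV where "EV k = (\<integral>\<omega>. PD.V (x k \<omega>) (W k \<omega>) \<partial>M)" for k
  define N where "N = (n * d / 4) * (2 * \<alpha>\<^sup>2 + \<beta>\<^sup>2) * \<rho>L\<^sup>2 * \<Delta>\<^sup>2 + 2 * n * \<sigma>\<^sup>2"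
  have N_nonneg: "0 \<le> N" by (simp add: N_def n d)
  define c where "c = h\<^sup>2 * (\<eta> / 2) * N"
  have c_nonneg: "0 \<le> c" using N_nonneg PD.\<eta>_bounds(3) by (simp add: c_def)
  have EV_Suc: "EV (Suc k) \<le> (1 - PD.rate) * EV k + c" for k
  proof -
    have sk: "square_integrable M (x k)" "square_integrable M (W k)" using sq by auto
    have "EV (Suc k) \<le> (1 - PD.rate) * EV k
        + h\<^sup>2 * (\<eta> / 2) * ((2 * \<alpha>\<^sup>2 + \<beta>\<^sup>2) * \<rho>L\<^sup>2 * (n * (d * \<Delta>\<^sup>2 / 4)) + 2 * (n * \<sigma>\<^sup>2))"
      unfolding EV_def
      by (rule PD.expected_V_contracts[OF M sk filt(2) adapted(1) TW_adapted \<xi>_moment(1) \<xi>_orth \<xi>_moment(2)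
          \<zeta>_moment(1) \<zeta>_orth \<zeta>_moment(2) x_Suc W_Suc PD.integrable_V[OF M]]) (use sq in auto)
    also have "(2 * \<alpha>\<^sup>2 + \<beta>\<^sup>2) * \<rho>L\<^sup>2 * (n * (d * \<Delta>\<^sup>2 / 4)) + 2 * (n * \<sigma>\<^sup>2) = N"
      by (simp add: N_def)
    finally show ?thesis by (simp only: c_def)
  qed
  have EV_le: "EV k \<le> (1 - PD.rate) ^ k * EV 0 + c / PD.rate" for k
    by (rule affine_recursion_le[where a = EV, OF _ rate(2,3) c_nonneg]) (rule EV_Suc)
  have EV_nonneg: "0 \<le> EV k" for k
    unfolding EV_def
  proof (rule Bochner_Integration.integral_nonneg)
    show "0 \<le> PD.V (x k \<omega>) (W k \<omega>)" for \<omega>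
      using PD.V_bounds(1)[of "x k \<omega>" "W k \<omega>"] step(1)
      by (smt (verit) mult_nonneg_nonneg zero_le_power2)
  qed
  \<comment> \<open>The fixed point of the recursion, converted from \<open>V\<close> to squared distances.\<close>
  have steady: "c / PD.rate / \<epsilon>4 = A * \<Delta>\<^sup>2 + B * \<sigma>\<^sup>2"
  proof -
    define Den where "Den = 2 * \<epsilon>2 * \<epsilon>4 - h * \<eta> * \<epsilon>3 * \<epsilon>5"
    have Den: "Den \<noteq> 0" "\<epsilon>3 \<noteq> 0" "\<epsilon>4 \<noteq> 0" "h \<noteq> 0"
      using step(1,2) PD.\<epsilon>3_pos h_pos by (auto simp: Den_def)
    have "PD.rate = h * Den / (2 * \<epsilon>3 * \<epsilon>4)" unfolding rate(1) \<rho> Den_def by simp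
    then have "c / PD.rate / \<epsilon>4 = (\<epsilon>3 * \<eta> * h / Den) * N"
      using Den by (simp add: c_def power2_eq_square)
    also have "\<dots> = A * \<Delta>\<^sup>2 + B * \<sigma>\<^sup>2"
    proof -
      have "t * (w * a\<^sub>1 * b\<^sub>1 * s + p * z) = t * w * a\<^sub>1 * b\<^sub>1 * s + t * p * z"
        for t w a\<^sub>1 b\<^sub>1 s p z :: real
        by (simp only: distrib_left mult.assoc)
      then show ?thesis unfolding A B Den_def[symmetric] N_def .
    qed
    finally show ?thesis .
  qed

  \<comment> \<open>The summand 1 only keeps \<open>C\<close> positive when the iteration starts at an optimum.\<close>
  define C where "C = sqrt (EV 0 / \<epsilon>4) + 1"
  have C_pos: "0 < C" using EV_nonneg[of 0] step(1) by (simp add: C_def add_nonneg_pos)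
  have bound: "integrable M (\<lambda>\<omega>. norm (x k \<omega> - closest_point XXs (x k \<omega>)))
      \<and> (\<integral>\<omega>. norm (x k \<omega> - closest_point XXs (x k \<omega>)) \<partial>M) \<le> C * \<rho> ^ k + sqrt (A * \<Delta>\<^sup>2 + B * \<sigma>\<^sup>2)" for k
  proof -
    have sk: "square_integrable M (x k)" "square_integrable M (W k)" using sq by auto
    have dev: "square_integrable M (\<lambda>\<omega>. PD.dev (x k \<omega>))" by (rule PD.square_integrable_dev[OF M sk])
    have "(\<integral>\<omega>. \<epsilon>4 * (norm (PD.dev (x k \<omega>)))\<^sup>2 \<partial>M) \<le> EV k"
      unfolding EV_def
    proof (rule integral_mono[OF _ PD.integrable_V[OF M sk]])
      show "integrable M (\<lambda>\<omega>. \<epsilon>4 * (norm (PD.dev (x k \<omega>)))\<^sup>2)"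
        using dev by (simp add: square_integrable_def)
      fix \<omega>
      have "\<epsilon>4 * (norm (PD.dev (x k \<omega>)))\<^sup>2 \<le> \<epsilon>4 * ((norm (PD.dev (x k \<omega>)))\<^sup>2 + (norm (?T (W k \<omega>)))\<^sup>2)"
        using step(1) by (intro mult_left_mono) auto
      then show "\<epsilon>4 * (norm (PD.dev (x k \<omega>)))\<^sup>2 \<le> PD.V (x k \<omega>) (W k \<omega>)"
        using PD.V_bounds(1) by (rule order_trans)
    qed
    then have "(\<integral>\<omega>. (norm (PD.dev (x k \<omega>)))\<^sup>2 \<partial>M) \<le> EV k / \<epsilon>4"
      using step(1) by (simp add: field_simps)
    also have "\<dots> \<le> ((1 - PD.rate) ^ k * EV 0 + c / PD.rate) / \<epsilon>4"
      using step(1) by (intro divide_right_mono EV_le) auto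
    also have "\<dots> = (1 - PD.rate) ^ k * (EV 0 / \<epsilon>4) + (A * \<Delta>\<^sup>2 + B * \<sigma>\<^sup>2)"
      unfolding steady[symmetric] by (simp add: add_divide_distrib)
    finally have second: "(\<integral>\<omega>. (norm (PD.dev (x k \<omega>)))\<^sup>2 \<partial>M)
      \<le> (1 - PD.rate) ^ k * (EV 0 / \<epsilon>4) + (A * \<Delta>\<^sup>2 + B * \<sigma>\<^sup>2)" .
    have "0 \<le> c / PD.rate / \<epsilon>4" using c_nonneg rate(2) step(1) by simp
    then have AB: "0 \<le> A * \<Delta>\<^sup>2 + B * \<sigma>\<^sup>2" by (simp only: steady)
    have half: "1 - PD.rate / 2 = \<rho>" unfolding rate(1) by (simp add: field_simps)
    have "(\<integral>\<omega>. norm (PD.dev (x k \<omega>)) \<partial>M) \<le> sqrt (\<integral>\<omega>. (norm (PD.dev (x k \<omega>)))\<^sup>2 \<partial>M)"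
      by (rule square_integrable_integrable_norm(2)[OF M dev])
    also have "\<dots> \<le> sqrt ((1 - PD.rate) ^ k * (EV 0 / \<epsilon>4) + (A * \<Delta>\<^sup>2 + B * \<sigma>\<^sup>2))"
      by (rule real_sqrt_le_mono[OF second])
    also have "\<dots> \<le> sqrt (EV 0 / \<epsilon>4) * (1 - PD.rate / 2) ^ k + sqrt (A * \<Delta>\<^sup>2 + B * \<sigma>\<^sup>2)"
      using rate EV_nonneg[of 0] step(1) AB by (intro sqrt_geometric_le) auto
    also have "\<dots> \<le> C * \<rho> ^ k + sqrt (A * \<Delta>\<^sup>2 + B * \<sigma>\<^sup>2)"
      unfolding half using \<rho>_range by (intro add_mono mult_right_mono) (auto simp: C_def)
    finally show ?thesis
      using square_integrable_integrable_norm(1)[OF M dev] by (simp add: PD.dev_def)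
  qed
  show ?thesis using \<rho>_range C_pos bound by blast
qed

end
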